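(* Let $\alpha>1$ be real. The solution to the space-fractional Cauchy problem $$\frac{\partial^2 u_{2\alpha}}{\partial t^2}(x,t)=\frac{\partial^{2\alpha}u_{2\alpha}}{\partial |x|^{2\alpha}}(x,t),\quad x\in\mathbb{R},\ t>0,\qquad u_{2\alpha}(x,0)=\delta(x),\qquad \frac{\partial u_{2\alpha}}{\partial t}(x,0)=0,$$ where $\frac{\partial^{2\alpha}}{\partial|x|^{2\alpha}}$ is the Riesz fractional derivative and $\delta$ is the Dirac delta, can be expressed in the form $$u_{2\alpha}(x,t)=\frac{1}{2(\alpha t)^{1/\alpha}}\left[\mathrm{Ai}_{\alpha}\left(\frac{x}{(\alpha t)^{1/\alpha}}\right)+\mathrm{Ai}_{\alpha}\left(-\frac{x}{(\alpha t)^{1/\alpha}}\right)\right],\qquad x\in\mathbb{R},\ t>0.$$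
   Context: For real $\alpha>1$ the generalized Airy function is $\mathrm{Ai}_{\alpha}(x)=\frac{1}{\pi}\int_0^{+\infty}\cos\left(sx+\frac{s^{\alpha}}{\alpha}\right)ds$, $x\in\mathbb{R}$ (convergent improper Riemann integral). The Riesz fractional derivative of order $\beta>0$ is defined through its Fourier transform: $\mathcal{F}\left\{\frac{\partial^{\beta}f}{\partial|x|^{\beta}}\right\}(\gamma)=-|\gamma|^{\beta}\mathcal{F}\{f\}(\gamma)$, where $\mathcal F\{f\}(\gamma)=\int_{-\infty}^{+\infty}e^{i\gamma x}f(x)\,dx$ (in the sense of tempered distributions). "Solution" is understood through the Fourier transform in $x$: $u(\cdot,t)$ is the solution if, for each $t>0$, its Fourier transform is the function $\gamma\mapsto\widehat u(\gamma,t)$, where for every $\gamma\in\mathbb{R}$ the function $t\mapsto\widehat u(\gamma,t)$ is the solution to $\frac{\partial^2\widehat u}{\partial t^2}(\gamma,t)=-|\gamma|^{2\alpha}\widehat u(\gamma,t)$ on $t\ge0$ with $\widehat u(\gamma,0)=1$, $\frac{\partial\widehat u}{\partial t}(\gamma,0)=0$. *)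

theory Defs
  imports "HOL-Analysis.Analysis"
begin

definition airy :: "real \<Rightarrow> real \<Rightarrow> real" where
  "airy \<alpha> x = 1 / pi * Lim at_top (\<lambda>R. integral {0..R} (\<lambda>s. cos (s * x + s powr \<alpha> / \<alpha>)))"

definition nth_deriv :: "nat \<Rightarrow> (real \<Rightarrow> complex) \<Rightarrow> real \<Rightarrow> complex" where
  "nth_deriv n \<phi> = ((\<lambda>f x. vector_derivative f (at x)) ^^ n) \<phi>"

definition schwartz :: "(real \<Rightarrow> complex) set" where
  "schwartz = {\<phi>. (\<forall>n x. nth_deriv n \<phi> differentiable (at x)) \<and>
                  (\<forall>k n. bounded (range (\<lambda>x. x ^ k *\<^sub>R nth_deriv n \<phi> x)))}"

definition schwartz_tendsto :: "(nat \<Rightarrow> real \<Rightarrow> complex) \<Rightarrow> (real \<Rightarrow> complex) \<Rightarrow> bool" where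
  "schwartz_tendsto \<Phi> \<phi> \<longleftrightarrow>
     (\<forall>k n. uniform_limit UNIV (\<lambda>j x. x ^ k *\<^sub>R nth_deriv n (\<Phi> j) x)
              (\<lambda>x. x ^ k *\<^sub>R nth_deriv n \<phi> x) sequentially)"

text \<open>
  A tempered distribution is a functional on the Schwartz space; its values outside
  \<^const>\<open>schwartz\<close> are irrelevant. The Schwartz space is metrizable, so sequential
  continuity is continuity.
\<close>

definition tempered_distribution :: "((real \<Rightarrow> complex) \<Rightarrow> complex) \<Rightarrow> bool" where
  "tempered_distribution T \<longleftrightarrow>
     (\<forall>\<phi>\<in>schwartz. \<forall>\<psi>\<in>schwartz. \<forall>a b.
        T (\<lambda>x. a * \<phi> x + b * \<psi> x) = a * T \<phi> + b * T \<psi>) \<and>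
     (\<forall>\<Phi>. \<forall>\<phi>\<in>schwartz. (\<forall>j. \<Phi> j \<in> schwartz) \<longrightarrow> schwartz_tendsto \<Phi> \<phi> \<longrightarrow>
        (\<lambda>j. T (\<Phi> j)) \<longlonglongrightarrow> T \<phi>)"

text \<open>
  The distribution \<open>T\<close> is the function \<open>f\<close>. Integrability is required explicitly because
  the integral of a non-integrable function is \<open>0\<close> by convention.
\<close>

definition represented_by :: "((real \<Rightarrow> complex) \<Rightarrow> complex) \<Rightarrow> (real \<Rightarrow> complex) \<Rightarrow> bool" where
  "represented_by T f \<longleftrightarrow>
     (\<forall>\<phi>\<in>schwartz. integrable lborel (\<lambda>x. f x * \<phi> x) \<and>
        T \<phi> = (LINT x|lborel. f x * \<phi> x))"

definition fourier :: "(real \<Rightarrow> complex) \<Rightarrow> real \<Rightarrow> complex" where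
  "fourier f \<gamma> = (LINT x|lborel. exp (\<i> * of_real (\<gamma> * x)) * f x)"

definition fourier_distribution ::
    "((real \<Rightarrow> complex) \<Rightarrow> complex) \<Rightarrow> (real \<Rightarrow> complex) \<Rightarrow> complex" where
  "fourier_distribution T \<phi> = T (fourier \<phi>)"

text \<open>The Fourier multiplier that defines the Riesz derivative of order \<open>\<beta>\<close>.\<close>

definition riesz_symbol :: "real \<Rightarrow> real \<Rightarrow> real" where
  "riesz_symbol \<beta> \<gamma> = - (\<bar>\<gamma>\<bar> powr \<beta>)"

text \<open>
  The initial value problem at frequency \<open>\<gamma>\<close> obtained by Fourier transform in \<open>x\<close>. The
  initial datum \<open>1\<close> is the transform of the Dirac delta, and \<open>w\<close> is the time derivative
  of \<open>v\<close>, one-sided at \<open>0\<close>.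
\<close>

definition solves_transformed_problem :: "real \<Rightarrow> real \<Rightarrow> (real \<Rightarrow> complex) \<Rightarrow> bool" where
  "solves_transformed_problem \<beta> \<gamma> v \<longleftrightarrow>
     (\<exists>w. (\<forall>t\<ge>0. (v has_vector_derivative w t) (at t within {0..})) \<and>
          (\<forall>t\<ge>0. (w has_vector_derivative riesz_symbol \<beta> \<gamma> *\<^sub>R v t) (at t within {0..})) \<and>
          v 0 = 1 \<and> w 0 = 0)"

definition solves_cauchy_problem ::
    "real \<Rightarrow> (real \<Rightarrow> (real \<Rightarrow> complex) \<Rightarrow> complex) \<Rightarrow> bool" where
  "solves_cauchy_problem \<beta> u \<longleftrightarrow>
     (\<exists>v. (\<forall>\<gamma>. solves_transformed_problem \<beta> \<gamma> (v \<gamma>)) \<and>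
          (\<forall>t>0. tempered_distribution (u t) \<and>
                 represented_by (fourier_distribution (u t)) (\<lambda>\<gamma>. v \<gamma> t)))"

end

(*
  In the frequency g the solution is cos (|g|^alpha t). Cutting this symbol off at |g| <= n and
  substituting s = (alpha t)^(1/alpha) g turns its inverse Fourier transform into the sum of two
  truncated Airy integrals. Integration against a monotone amplitude (second mean value theorem)
  shows that these converge and are bounded, uniformly in n, by a polynomial in x, so by dominated
  convergence the limit can be taken under the pairing with a Schwartz function. Fourier inversion on
  the Schwartz space then gives both existence and uniqueness.
*)
theory Submission
  imports Defs "HOL-Probability.Probability" "HOL-Real_Asymp.Real_Asymp"
begin

text \<open>The obstacle is that the cosine symbol is bounded but not integrable: its inverse
  transform is only conditionally convergent, and Fubini does not apply to it. The cut-off makes the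
  multiplication formula available, and everything after that is a passage to the limit. The
  hypothesis \<alpha> > 1 enters through the phase derivative y + s^(\<alpha> - 1), which increases
  to infinity. Stationary points are therefore confined to an interval whose length is polynomial in
  y; that length is the source of the polynomial bound on the kernel. Evenness of the symbol has two
  effects. It makes both signs of x appear in the solution, and it absorbs the reflection x -> -x
  that two Fourier transforms produce. A transformed distribution tests the original one on Fourier
  transforms only, so inversion serves twice: to evaluate the kernel on such functions, and to see
  that they exhaust the Schwartz space.\<close>

abbreviation vderiv :: "(real \<Rightarrow> complex) \<Rightarrow> real \<Rightarrow> complex" where
  "vderiv f \<equiv> \<lambda>x. vector_derivative f (at x)"

section \<open>The transformed problem\<close>

lemma transformed_problem_cos:
  "solves_transformed_problem (2 * \<alpha>) \<gamma> (\<lambda>t. of_real (cos (\<bar>\<gamma>\<bar> powr \<alpha> * t)))"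
proof -
  define l where "l = \<bar>\<gamma>\<bar> powr \<alpha>"
  have sym: "riesz_symbol (2 * \<alpha>) \<gamma> = - (l * l)"
    unfolding riesz_symbol_def l_def powr_add[symmetric] by simp
  show ?thesis
    unfolding solves_transformed_problem_def sym l_def[symmetric]
    by (intro exI[of _ "\<lambda>t. complex_of_real (- (l * sin (l * t)))"] conjI allI impI
              has_vector_derivative_of_real[THEN has_vector_derivative_eq_rhs])
       (auto intro!: derivative_eq_intros
             simp flip: has_real_derivative_iff_has_vector_derivative simp: scaleR_conv_of_real)
qed

text \<open>With l = |\<gamma>|^\<alpha>, the pair (l v, w) rotates in the plane with angular speed
  l. Undoing the rotation leaves two conserved quantities, from which l v is recovered by sin^2 +
  cos^2 = 1.\<close>

lemma transformed_problem_unique: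
  assumes "solves_transformed_problem (2 * \<alpha>) \<gamma> v" and "t \<ge> 0"
  shows "v t = of_real (cos (\<bar>\<gamma>\<bar> powr \<alpha> * t))"
proof -
  define l where "l = \<bar>\<gamma>\<bar> powr \<alpha>"
  have sym: "riesz_symbol (2 * \<alpha>) \<gamma> = - (l * l)"
    unfolding riesz_symbol_def l_def powr_add[symmetric] by simp
  obtain w where v: "\<And>t. t \<ge> 0 \<Longrightarrow> (v has_vector_derivative w t) (at t within {0..})"
    and w: "\<And>t. t \<ge> 0 \<Longrightarrow> (w has_vector_derivative - (l * l) *\<^sub>R v t) (at t within {0..})"
    and init: "v 0 = 1" "w 0 = 0"
    using assms(1) unfolding solves_transformed_problem_def sym by auto
  have const: "g t = g 0"
    if "\<And>t. t \<ge> 0 \<Longrightarrow> (g has_vector_derivative 0) (at t within {0..})" for g :: "real \<Rightarrow> complex"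
  proof -
    have "\<exists>c. \<forall>t\<in>{0..}. g t = c"
      by (rule has_derivative_zero_constant)
         (use that in \<open>auto simp: has_vector_derivative_def\<close>)
    then show ?thesis using \<open>t \<ge> 0\<close> by auto
  qed
  have c: "((\<lambda>t. complex_of_real (cos (l * t))) has_vector_derivative of_real (- (l * sin (l * t)))) (at t within {0..})"
   and s: "((\<lambda>t. complex_of_real (sin (l * t))) has_vector_derivative of_real (l * cos (l * t))) (at t within {0..})" for t
    by (rule has_vector_derivative_of_real,
        auto intro!: derivative_eq_intros simp flip: has_real_derivative_iff_has_vector_derivative)+
  show ?thesis
  proof (cases "l = 0")
    \<comment> \<open>The conserved quantities only determine \<open>l * v t\<close>, so frequency 0
      is separate: there \<open>w\<close> is constant, hence 0, and then \<open>v\<close> is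
      constant.\<close>
    case True
    have "v t = v 0"
    proof (rule const)
      fix r :: real assume r: "r \<ge> 0"
      have "\<exists>c. \<forall>t\<in>{0..}. w t = c"
        by (rule has_derivative_zero_constant)
           (use w True in \<open>auto simp: has_vector_derivative_def\<close>)
      then have "w r = 0" using init r by auto
      then show "(v has_vector_derivative 0) (at r within {0..})" using v[OF r] by simp
    qed
    then show ?thesis using True init by (simp add: l_def[symmetric])
  next
    case False
    \<comment> \<open>These are the coordinates of (w, l v) in the frame rotating by the angle
      \<open>l * t\<close>; their initial values are 0 and \<open>l\<close>.\<close>
    define p where "p = (\<lambda>t. w t * of_real (cos (l * t)) + l * (v t * of_real (sin (l * t))))"
    define q where "q = (\<lambda>t. l * (v t * of_real (cos (l * t))) - w t * of_real (sin (l * t)))"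
    have "(p has_vector_derivative 0) (at r within {0..})" if "r \<ge> 0" for r
      using has_vector_derivative_add[OF has_vector_derivative_mult[OF w[OF that] c]
          has_vector_derivative_mult_right[OF has_vector_derivative_mult[OF v[OF that] s]]]
      unfolding p_def by (rule has_vector_derivative_eq_rhs)
         (simp add: scaleR_conv_of_real algebra_simps)
    then have a: "p t = 0" using const[of p] init by (simp add: p_def)
    have "(q has_vector_derivative 0) (at r within {0..})" if "r \<ge> 0" for r
      using has_vector_derivative_diff[OF has_vector_derivative_mult_right[OF has_vector_derivative_mult[OF v[OF that] c]]
          has_vector_derivative_mult[OF w[OF that] s]]
      unfolding q_def by (rule has_vector_derivative_eq_rhs)
         (simp add: scaleR_conv_of_real algebra_simps)
    then have b: "q t = l" using const[of q] init by (simp add: q_def)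
    have one: "complex_of_real (cos (l * t)) * of_real (cos (l * t)) + of_real (sin (l * t)) * of_real (sin (l * t)) = 1"
      by (metis of_real_1 of_real_add of_real_mult power2_eq_square sin_cos_squared_add2)
    have "l * v t = l * complex_of_real (cos (l * t))"
      using a b one unfolding p_def q_def by algebra
    then show ?thesis using False by (simp add: l_def[symmetric])
  qed
qed

section \<open>Schwartz functions\<close>

lemma nth_deriv_0: "nth_deriv 0 f = f"
  by (simp add: nth_deriv_def)

lemma nth_deriv_Suc: "nth_deriv (Suc n) f = nth_deriv n (vderiv f)"
  unfolding nth_deriv_def by (simp only: funpow_Suc_right o_apply)

text \<open>The Schwartz space is the largest set of rapidly decreasing functions that is closed
  under differentiation. Working with a closed set \<open>P\<close> replaces formulas for n-th
  derivatives by a single differentiation.\<close>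

lemma schwartz_coinduct:
  assumes "f \<in> P"
    and der: "\<And>f. f \<in> P \<Longrightarrow> \<exists>f'\<in>P. \<forall>x. (f has_vector_derivative f' x) (at x)"
    and bdd: "\<And>f k. f \<in> P \<Longrightarrow> bounded (range (\<lambda>x. x ^ k *\<^sub>R f x))"
  shows "f \<in> schwartz"
proof -
  have diff: "vderiv f \<in> P" "f differentiable (at x)" if "f \<in> P" for f x
  proof -
    obtain f' where f': "f' \<in> P" "\<And>x. (f has_vector_derivative f' x) (at x)"
      using der[OF \<open>f \<in> P\<close>] by blast
    then have "vderiv f = f'" by (intro ext vector_derivative_at)
    with f' show "vderiv f \<in> P" "f differentiable (at x)"
      by (auto intro: differentiableI_vector)
  qed
  have "nth_deriv n f \<in> P" if "f \<in> P" for n f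
    using that by (induction n arbitrary: f) (simp_all add: nth_deriv_0 nth_deriv_Suc diff)
  then show ?thesis unfolding schwartz_def
    using diff(2) bdd \<open>f \<in> P\<close> by (intro CollectI conjI allI) simp_all
qed

lemma schwartz_has_vector_derivative:
  assumes "f \<in> schwartz"
  shows "(f has_vector_derivative vderiv f x) (at x)"
proof -
  have "nth_deriv 0 f differentiable (at x)"
    using assms unfolding schwartz_def mem_Collect_eq by iprover
  then show ?thesis
    by (simp add: nth_deriv_0 vector_derivative_works)
qed

lemma schwartz_bounded: "f \<in> schwartz \<Longrightarrow> bounded (range (\<lambda>x. x ^ k *\<^sub>R f x))"
  unfolding schwartz_def by (drule CollectD, drule conjunct2, drule spec[of _ k], drule spec[of _ 0])
    (simp add: nth_deriv_0)

lemma schwartz_vderiv: "f \<in> schwartz \<Longrightarrow> vderiv f \<in> schwartz"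
  unfolding schwartz_def mem_Collect_eq nth_deriv_Suc[symmetric] by iprover

lemma schwartz_continuous_on: "f \<in> schwartz \<Longrightarrow> continuous_on A f"
  using has_vector_derivative_continuous[OF schwartz_has_vector_derivative]
  by (intro continuous_at_imp_continuous_on ballI)

lemma schwartz_borel_measurable: "f \<in> schwartz \<Longrightarrow> f \<in> borel_measurable borel"
  by (intro borel_measurable_continuous_onI schwartz_continuous_on)

lemma schwartz_cmult:
  assumes "f \<in> schwartz"
  shows "(\<lambda>x. c * f x) \<in> schwartz"
proof (rule schwartz_coinduct)
  show "(\<lambda>x. c * f x) \<in> (\<lambda>f x. c * f x) ` schwartz"
    using assms by (rule imageI)
next
  fix h assume "h \<in> (\<lambda>f x. c * f x) ` schwartz"
  then obtain f where h: "h = (\<lambda>x. c * f x)" and f: "f \<in> schwartz" by blast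
  have "(h has_vector_derivative c * vderiv f x) (at x)" for x
    unfolding h by (intro has_vector_derivative_mult_right schwartz_has_vector_derivative f)
  moreover have "(\<lambda>x. c * vderiv f x) \<in> (\<lambda>f x. c * f x) ` schwartz"
    using schwartz_vderiv[OF f] by (rule imageI)
  ultimately show "\<exists>h'\<in>(\<lambda>f x. c * f x) ` schwartz. \<forall>x. (h has_vector_derivative h' x) (at x)"
    by (intro bexI allI)
  fix k
  obtain B where "\<And>x. norm (x ^ k *\<^sub>R f x) \<le> B"
    using schwartz_bounded[OF f, of k] by (auto simp: bounded_iff)
  then have "norm (x ^ k *\<^sub>R h x) \<le> norm c * B" for x
    using mult_left_mono[of "norm (x ^ k *\<^sub>R f x)" B "norm c"]
    by (simp add: h norm_mult mult.left_commute)
  then show "bounded (range (\<lambda>x. x ^ k *\<^sub>R h x))"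
    unfolding bounded_iff by blast
qed

lemma schwartz_add:
  assumes "f \<in> schwartz" "g \<in> schwartz"
  shows "(\<lambda>x. f x + g x) \<in> schwartz"
proof (rule schwartz_coinduct)
  let ?P = "\<Union>f\<in>schwartz. (\<lambda>g x. f x + g x) ` schwartz"
  show "(\<lambda>x. f x + g x) \<in> ?P"
    using assms(1) imageI[OF assms(2)] by (rule UN_I)
  fix h assume "h \<in> ?P"
  then obtain f g where h: "h = (\<lambda>x. f x + g x)" and f: "f \<in> schwartz" and g: "g \<in> schwartz" by blast
  have "(h has_vector_derivative vderiv f x + vderiv g x) (at x)" for x
    unfolding h by (intro has_vector_derivative_add schwartz_has_vector_derivative f g)
  moreover have "(\<lambda>x. vderiv f x + vderiv g x) \<in> ?P"
    using schwartz_vderiv[OF f] imageI[OF schwartz_vderiv[OF g]] by (rule UN_I)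
  ultimately show "\<exists>h'\<in>?P. \<forall>x. (h has_vector_derivative h' x) (at x)"
    by (intro bexI allI)
  show "bounded (range (\<lambda>x. x ^ k *\<^sub>R h x))" for k
    unfolding h scaleR_add_right by (intro bounded_plus_comp schwartz_bounded f g)
qed

lemma schwartz_mult_id:
  assumes "f \<in> schwartz"
  shows "(\<lambda>x. of_real x * f x) \<in> schwartz"
proof (rule schwartz_coinduct)
  \<comment> \<open>The derivative of x f is x f' + f. The free summand \<open>g\<close> absorbs the
    extra f and makes the set closed.\<close>
  let ?P = "\<Union>f\<in>schwartz. (\<lambda>g x. of_real x * f x + g x) ` schwartz"
  have "(\<lambda>x. of_real x * f x + 0 * f x) \<in> ?P"
    using assms imageI[OF schwartz_cmult[OF assms]] by (rule UN_I)
  then show "(\<lambda>x. of_real x * f x) \<in> ?P" by simp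
  fix h assume "h \<in> ?P"
  then obtain f g where h: "h = (\<lambda>x. of_real x * f x + g x)" and f: "f \<in> schwartz" and g: "g \<in> schwartz"
    by blast
  have "(h has_vector_derivative of_real x * vderiv f x + (f x + vderiv g x)) (at x)" for x
    unfolding h
    using has_vector_derivative_add[OF
        has_vector_derivative_mult[OF has_vector_derivative_of_real[OF DERIV_ident]
          schwartz_has_vector_derivative[OF f]] schwartz_has_vector_derivative[OF g]]
    by (simp add: algebra_simps)
  moreover have "(\<lambda>x. of_real x * vderiv f x + (f x + vderiv g x)) \<in> ?P"
    using schwartz_vderiv[OF f] imageI[OF schwartz_add[OF f schwartz_vderiv[OF g]]] by (rule UN_I)
  ultimately show "\<exists>h'\<in>?P. \<forall>x. (h has_vector_derivative h' x) (at x)"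
    by (intro bexI allI)
  have "bounded (range (\<lambda>x. x ^ Suc k *\<^sub>R f x + x ^ k *\<^sub>R g x))" for k
    by (intro bounded_plus_comp schwartz_bounded f g)
  then show "bounded (range (\<lambda>x. x ^ k *\<^sub>R h x))" for k
    unfolding h by (simp add: scaleR_conv_of_real algebra_simps)
qed

section \<open>Weighted decay and integrability of Schwartz functions\<close>

text \<open>The larger of 1 and x^2 is at least half of 1 + x^2. This turns the monomial bounds in
  \<open>schwartz\<close> into bounds with a strictly positive weight, by which one can
  divide.\<close>

lemma one_plus_square_power_le: "(1 + x\<^sup>2) ^ m \<le> 2 ^ m * (1 + x ^ (2 * m))" for x :: real
proof (cases "x\<^sup>2 \<le> 1")
  case True
  then have "(1 + x\<^sup>2) ^ m \<le> 2 ^ m" by (intro power_mono) auto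
  also have "\<dots> \<le> 2 ^ m * (1 + x ^ (2 * m))" by (simp add: power_mult)
  finally show ?thesis .
next
  case False
  then have "(1 + x\<^sup>2) ^ m \<le> (2 * x\<^sup>2) ^ m" by (intro power_mono) auto
  also have "\<dots> \<le> 2 ^ m * (1 + x ^ (2 * m))" by (simp add: power_mult_distrib power_mult)
  finally show ?thesis .
qed

lemma schwartz_decay:
  assumes "f \<in> schwartz"
  obtains C where "\<And>x. (1 + x\<^sup>2) ^ m * norm (f x) \<le> C"
proof -
  obtain A B where A: "\<And>x. norm (f x) \<le> A" and B: "\<And>x. norm (x ^ (2 * m) *\<^sub>R f x) \<le> B"
    using schwartz_bounded[OF assms, of 0] schwartz_bounded[OF assms, of "2 * m"]
    by (auto simp: bounded_iff)
  have "(1 + x\<^sup>2) ^ m * norm (f x) \<le> 2 ^ m * (A + B)" for x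
  proof -
    have "(1 + x\<^sup>2) ^ m * norm (f x) \<le> (2 ^ m * (1 + x ^ (2 * m))) * norm (f x)"
      by (intro mult_right_mono one_plus_square_power_le) simp
    also have "\<dots> = 2 ^ m * (norm (f x) + norm (x ^ (2 * m) *\<^sub>R f x))"
      by (simp add: algebra_simps power_mult)
    also have "\<dots> \<le> 2 ^ m * (A + B)"
      using A B by (intro mult_left_mono add_mono) auto
    finally show ?thesis .
  qed
  then show ?thesis by (rule that)
qed

lemma integrable_inverse_one_plus_square: "integrable lborel (\<lambda>x::real. inverse (1 + x\<^sup>2))"
  using integrable_inverse_1_plus_square
  by (simp add: set_integrable_def)

lemma schwartz_integrable_poly_mult:
  fixes g :: "real \<Rightarrow> complex"
  assumes f: "f \<in> schwartz" and [measurable]: "g \<in> borel_measurable borel"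
    and g: "\<And>x. norm (g x) \<le> C * (1 + x\<^sup>2) ^ m"
  shows "integrable lborel (\<lambda>x. g x * f x)"
proof -
  \<comment> \<open>One power more than the growth of \<open>g\<close>: the spare factor leaves the
    integrable majorant 1 / (1 + x^2).\<close>
  obtain B where B: "\<And>x. (1 + x\<^sup>2) ^ Suc m * norm (f x) \<le> B"
    using schwartz_decay[OF f] by blast
  note [measurable] = schwartz_borel_measurable[OF f]
  have C: "0 \<le> C" using order_trans[OF norm_ge_zero g[of 0]] by simp
  have "norm (g x * f x) \<le> C * B * inverse (1 + x\<^sup>2)" for x
  proof -
    have pos: "1 + x\<^sup>2 > 0" by (simp add: add_pos_nonneg)
    have "norm (g x * f x) \<le> C * (1 + x\<^sup>2) ^ m * norm (f x)"
      unfolding norm_mult by (intro mult_right_mono g) simp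
    also have "\<dots> = C * ((1 + x\<^sup>2) ^ Suc m * norm (f x)) * inverse (1 + x\<^sup>2)"
      using pos by (simp add: field_simps)
    also have "\<dots> \<le> C * B * inverse (1 + x\<^sup>2)"
      using pos C by (intro mult_right_mono mult_left_mono B) auto
    finally show ?thesis .
  qed
  then have bound: "AE x in lborel. norm (g x * f x) \<le> norm (C * B * inverse (1 + x\<^sup>2))"
    unfolding real_norm_def by (intro AE_I2 order_trans[OF _ abs_ge_self])
  have "integrable lborel (\<lambda>x::real. C * B * inverse (1 + x\<^sup>2))"
    using integrable_inverse_one_plus_square by (rule integrable_mult_right)
  moreover have "(\<lambda>x. g x * f x) \<in> borel_measurable lborel" by measurable
  ultimately show ?thesis using bound by (rule Bochner_Integration.integrable_bound)
qed

lemma schwartz_integrable_bounded_mult: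
  fixes g :: "real \<Rightarrow> complex"
  assumes "f \<in> schwartz" "g \<in> borel_measurable borel" "\<And>x. norm (g x) \<le> C"
  shows "integrable lborel (\<lambda>x. g x * f x)"
  using schwartz_integrable_poly_mult[of f g C 0] assms by simp

lemma schwartz_integrable: "f \<in> schwartz \<Longrightarrow> integrable lborel f"
  using schwartz_integrable_bounded_mult[of f "\<lambda>_. 1" 1] by simp

section \<open>The Fourier transform\<close>

lemma norm_fourier_le: "norm (fourier f \<gamma>) \<le> (LINT x|lborel. norm (f x))"
  unfolding fourier_def
  by (rule order_trans[OF integral_norm_bound]) (simp add: norm_mult)

lemma integrable_iexp_mult:
  fixes f :: "real \<Rightarrow> complex"
  assumes "integrable lborel f"
  shows "integrable lborel (\<lambda>x. exp (\<i> * of_real (\<gamma> * x)) * f x)"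
proof (rule Bochner_Integration.integrable_bound[OF assms])
  note [measurable] = borel_measurable_integrable[OF assms]
  show "(\<lambda>x. exp (\<i> * of_real (\<gamma> * x)) * f x) \<in> borel_measurable lborel" by measurable
qed (simp add: norm_mult)

lemma fourier_borel_measurable:
  assumes "integrable lborel f"
  shows "fourier f \<in> borel_measurable borel"
proof -
  note [measurable] = borel_measurable_integrable[OF assms]
  show ?thesis unfolding fourier_def by measurable
qed

text \<open>Fubini for a kernel symmetric in both variables; since it has modulus 1, absolute
  integrability reduces to that of f(x) g(y). The formula moves a transform from a symbol to a test
  function.\<close>

lemma fourier_multiplication:
  assumes f: "integrable lborel f" and g: "integrable lborel g"
  shows "(LINT x|lborel. f x * fourier g x) = (LINT x|lborel. fourier f x * g x)"
proof -
  note [measurable] = borel_measurable_integrable[OF f] borel_measurable_integrable[OF g]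
  define h where "h = (\<lambda>x y. f x * (exp (\<i> * of_real (x * y)) * g y))"
  have "integrable (lborel \<Otimes>\<^sub>M lborel) (case_prod h)"
  proof (rule lborel_pair.Fubini_integrable)
    show "case_prod h \<in> borel_measurable (lborel \<Otimes>\<^sub>M lborel)"
      unfolding h_def by measurable
    have "(LINT y|lborel. norm (case_prod h (x, y))) = norm (f x) * (LINT y|lborel. norm (g y))" for x
      by (simp add: h_def norm_mult)
    then show "integrable lborel (\<lambda>x. LINT y|lborel. norm (case_prod h (x, y)))"
      using f by simp
    show "AE x in lborel. integrable lborel (\<lambda>y. case_prod h (x, y))"
      using integrable_iexp_mult[OF g] by (simp add: h_def)
  qed
  then have "(LINT y|lborel. LINT x|lborel. h x y) = (LINT x|lborel. LINT y|lborel. h x y)"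
    by (rule lborel_pair.Fubini_integral)
  moreover have "(LINT x|lborel. h x y) = fourier f y * g y" for y
  proof -
    have "(LINT x|lborel. h x y) = (LINT x|lborel. (exp (\<i> * of_real (y * x)) * f x) * g y)"
      by (simp add: h_def mult_ac)
    then show ?thesis unfolding fourier_def by simp
  qed
  moreover have "(LINT y|lborel. h x y) = f x * fourier g x" for x
    unfolding h_def fourier_def by simp
  ultimately show ?thesis by simp
qed

text \<open>The Taylor estimate |exp(iu) - 1 - iu| \<le> u^2 / 2 with u = (\<gamma>' - \<gamma>) x
  makes the error of the linear approximation quadratic in \<gamma>' - \<gamma>. Its constant is
  half the second absolute moment of \<open>f\<close>.\<close>

lemma fourier_has_vector_derivative:
  assumes f: "f \<in> schwartz"
  shows "(fourier f has_vector_derivative fourier (\<lambda>x. \<i> * (of_real x * f x)) \<gamma>) (at \<gamma>)"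
proof -
  define g where "g = (\<lambda>x. \<i> * (of_real x * f x))"
  define C where "C = (LINT x|lborel. norm (of_real x * (of_real x * f x)) / 2)"
  have g: "g \<in> schwartz" unfolding g_def by (intro schwartz_cmult schwartz_mult_id f)
  have xxf: "(\<lambda>x. of_real x * (of_real x * f x)) \<in> schwartz" by (intro schwartz_mult_id f)
  have taylor: "norm (exp (\<i> * of_real u) - 1 - \<i> * of_real u) \<le> u\<^sup>2 / 2" for u :: real
    using iexp_approx1[of u 1] by (simp add: power2_eq_square algebra_simps)
  have est: "norm (fourier f \<gamma>' - fourier f \<gamma> - (\<gamma>' - \<gamma>) *\<^sub>R fourier g \<gamma>) \<le> (\<gamma>' - \<gamma>)\<^sup>2 * C" for \<gamma>'
  proof -
    note int = integrable_iexp_mult[OF schwartz_integrable[OF f]]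
      integrable_iexp_mult[OF schwartz_integrable[OF g]]
    have "fourier f \<gamma>' - fourier f \<gamma> - (\<gamma>' - \<gamma>) *\<^sub>R fourier g \<gamma> =
      (LINT x|lborel. exp (\<i> * of_real (\<gamma>' * x)) * f x - exp (\<i> * of_real (\<gamma> * x)) * f x
          - (\<gamma>' - \<gamma>) *\<^sub>R (exp (\<i> * of_real (\<gamma> * x)) * g x))"
      unfolding fourier_def using int by simp
    also have "norm \<dots> \<le> (LINT x|lborel. (\<gamma>' - \<gamma>)\<^sup>2 * (norm (of_real x * (of_real x * f x)) / 2))"
    proof (rule Bochner_Integration.integral_norm_bound_integral)
      show "integrable lborel (\<lambda>x. exp (\<i> * of_real (\<gamma>' * x)) * f x - exp (\<i> * of_real (\<gamma> * x)) * f x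
          - (\<gamma>' - \<gamma>) *\<^sub>R (exp (\<i> * of_real (\<gamma> * x)) * g x))"
        by (intro Bochner_Integration.integrable_diff integrable_scaleR_right int)
      show "integrable lborel (\<lambda>x. (\<gamma>' - \<gamma>)\<^sup>2 * (norm (of_real x * (of_real x * f x)) / 2))"
        by (intro integrable_mult_right integrable_divide integrable_norm schwartz_integrable xxf)
      fix x :: real
      have "exp (\<i> * of_real (\<gamma>' * x)) * f x - exp (\<i> * of_real (\<gamma> * x)) * f x
          - (\<gamma>' - \<gamma>) *\<^sub>R (exp (\<i> * of_real (\<gamma> * x)) * g x)
        = exp (\<i> * of_real (\<gamma> * x)) * ((exp (\<i> * of_real ((\<gamma>' - \<gamma>) * x)) - 1
            - \<i> * of_real ((\<gamma>' - \<gamma>) * x)) * f x)"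
      proof -
        have "exp (\<i> * of_real (\<gamma>' * x)) = exp (\<i> * of_real (\<gamma> * x)) * exp (\<i> * of_real ((\<gamma>' - \<gamma>) * x))"
          by (simp flip: exp_add of_real_add add: algebra_simps)
        then show ?thesis by (simp add: g_def scaleR_conv_of_real algebra_simps)
      qed
      also have "norm \<dots> \<le> ((\<gamma>' - \<gamma>) * x)\<^sup>2 / 2 * norm (f x)"
        unfolding norm_mult norm_exp_i_times mult_1
        by (intro mult_right_mono taylor) simp
      also have "\<dots> = (\<gamma>' - \<gamma>)\<^sup>2 * (norm (of_real x * (of_real x * f x)) / 2)"
        by (simp add: norm_mult power2_eq_square)
      finally show "norm (exp (\<i> * of_real (\<gamma>' * x)) * f x - exp (\<i> * of_real (\<gamma> * x)) * f x
          - (\<gamma>' - \<gamma>) *\<^sub>R (exp (\<i> * of_real (\<gamma> * x)) * g x))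
        \<le> (\<gamma>' - \<gamma>)\<^sup>2 * (norm (of_real x * (of_real x * f x)) / 2)" .
    qed
    also have "\<dots> = (\<gamma>' - \<gamma>)\<^sup>2 * C" unfolding C_def by simp
    finally show ?thesis .
  qed
  show ?thesis
    unfolding has_vector_derivative_def g_def[symmetric]
  proof (rule has_derivativeI_sandwich[of 1])
    show "bounded_linear (\<lambda>h. h *\<^sub>R fourier g \<gamma>)" by (rule bounded_linear_scaleR_left)
    show "norm (fourier f y - fourier f \<gamma> - (y - \<gamma>) *\<^sub>R fourier g \<gamma>) / norm (y - \<gamma>) \<le> \<bar>y - \<gamma>\<bar> * C"
      if "y \<noteq> \<gamma>" for y
      using est[of y] that by (simp add: divide_le_eq power2_eq_square mult_ac)
    have "((\<lambda>y. \<bar>y - \<gamma>\<bar> * C) \<longlongrightarrow> \<bar>\<gamma> - \<gamma>\<bar> * C) (at \<gamma>)" by (intro tendsto_intros)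
    then show "((\<lambda>y. \<bar>y - \<gamma>\<bar> * C) \<longlongrightarrow> 0) (at \<gamma>)" by simp
  qed simp
qed

text \<open>Integration by parts: \<open>G'\<close> is the derivative of x -> exp(i \<gamma> x)
  f(x), which vanishes at both ends, so \<open>G'\<close> has integral 0.\<close>

lemma fourier_vderiv:
  assumes f: "f \<in> schwartz"
  shows "of_real \<gamma> * fourier f \<gamma> = \<i> * fourier (vderiv f) \<gamma>"
proof -
  define e where "e = (\<lambda>x. exp (\<i> * complex_of_real (\<gamma> * x)))"
  define G' where "G' = (\<lambda>x. e x * vderiv f x + (of_real \<gamma> * \<i>) * (e x * f x))"
  have e: "(e has_vector_derivative (of_real \<gamma> * \<i>) * e x) (at x)" for x
    unfolding e_def
    using field_vector_diff_chain_at[OF has_vector_derivative_mult_right[OF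
        has_vector_derivative_of_real[OF DERIV_cmult_Id]] DERIV_exp, of \<i> \<gamma> x]
    by (simp add: o_def mult_ac)
  have int: "integrable lborel (\<lambda>x. e x * f x)" "integrable lborel (\<lambda>x. e x * vderiv f x)"
    unfolding e_def by (intro integrable_iexp_mult schwartz_integrable schwartz_vderiv f)+
  have G'int: "integrable lborel G'" unfolding G'_def using int by simp
  have econt: "continuous_on UNIV e" unfolding e_def by (intro continuous_intros)
  have "(LBINT x=-\<infinity>..\<infinity>. G' x) = 0 - 0"
  proof (rule interval_integral_FTC_integrable)
    show "((\<lambda>x. e x * f x) has_vector_derivative G' x) (at x)" for x
      using has_vector_derivative_mult[OF e schwartz_has_vector_derivative[OF f], of x]
      by (simp add: G'_def mult_ac)
    have "continuous_on UNIV G'"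
      unfolding G'_def
      by (intro continuous_intros econt schwartz_continuous_on f schwartz_vderiv)
    then show "isCont G' x" for x by (simp add: continuous_on_eq_continuous_at)
    show "set_integrable lborel (einterval (- \<infinity>) \<infinity>) G'"
      using G'int by (simp add: set_integrable_def)
    obtain C where C: "\<And>x. (1 + x\<^sup>2) ^ 1 * norm (f x) \<le> C"
      using schwartz_decay[OF f] by blast
    have bound: "norm (e x * f x) \<le> C / (1 + x\<^sup>2)" for x
    proof -
      have "1 + x\<^sup>2 > 0" by (simp add: add_pos_nonneg)
      then show ?thesis using C[of x] by (simp add: e_def norm_mult pos_le_divide_eq mult.commute)
    qed
    have "((\<lambda>x. C / (1 + x\<^sup>2)) \<longlongrightarrow> 0) at_top" "((\<lambda>x. C / (1 + x\<^sup>2)) \<longlongrightarrow> 0) at_bot"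
      by real_asymp+
    then have "((\<lambda>x. e x * f x) \<longlongrightarrow> 0) at_top" "((\<lambda>x. e x * f x) \<longlongrightarrow> 0) at_bot"
      by (auto intro!: Lim_null_comparison[where f = "\<lambda>x. e x * f x"] always_eventually bound)
    then show "(((\<lambda>x. e x * f x) \<circ> real_of_ereal) \<longlongrightarrow> 0) (at_right (- \<infinity>))"
       "(((\<lambda>x. e x * f x) \<circ> real_of_ereal) \<longlongrightarrow> 0) (at_left \<infinity>)"
      by (simp_all add: ereal_tendsto_simps)
  qed simp
  then have "(LINT x|lborel. G' x) = 0"
    by (simp add: interval_lebesgue_integral_def set_lebesgue_integral_def)
  then have "fourier (vderiv f) \<gamma> + (of_real \<gamma> * \<i>) * fourier f \<gamma> = 0"
    unfolding G'_def using int by (simp add: fourier_def e_def)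
  then have "fourier (vderiv f) \<gamma> = - (of_real \<gamma> * \<i>) * fourier f \<gamma>"
    by (simp add: eq_neg_iff_add_eq_0)
  then show ?thesis by (simp add: mult_ac)
qed

text \<open>Transforms of Schwartz functions are closed under differentiation, since a derivative
  becomes multiplication by i x inside. For the decay, each power of the frequency is traded for a
  derivative of \<open>f\<close>.\<close>

lemma fourier_schwartz:
  assumes "f \<in> schwartz"
  shows "fourier f \<in> schwartz"
proof (rule schwartz_coinduct)
  show "fourier f \<in> fourier ` schwartz" using assms by (rule imageI)
  fix h assume "h \<in> fourier ` schwartz"
  then obtain f where h: "h = fourier f" and f: "f \<in> schwartz" by blast
  have "fourier (\<lambda>x. \<i> * (of_real x * f x)) \<in> fourier ` schwartz"
    by (intro imageI schwartz_cmult schwartz_mult_id f)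
  with fourier_has_vector_derivative[OF f]
  show "\<exists>h'\<in>fourier ` schwartz. \<forall>x. (h has_vector_derivative h' x) (at x)"
    unfolding h by (intro bexI allI)
  have "\<exists>B. \<forall>x. norm (x ^ k *\<^sub>R fourier f x) \<le> B" for k
    using f
  proof (induction k arbitrary: f)
    case 0
    then show ?case using norm_fourier_le[of f] by auto
  next
    case (Suc k)
    have "norm (x ^ Suc k *\<^sub>R fourier f x) = norm (x ^ k *\<^sub>R fourier (vderiv f) x)" for x
    proof -
      have "x ^ Suc k *\<^sub>R fourier f x = of_real x ^ k * (of_real x * fourier f x)"
        by (simp add: scaleR_conv_of_real)
      then show ?thesis unfolding fourier_vderiv[OF Suc.prems] by (simp add: norm_mult norm_power power_abs)
    qed
    then show ?case using Suc.IH[OF schwartz_vderiv[OF Suc.prems]] by simp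
  qed
  then show "bounded (range (\<lambda>x. x ^ k *\<^sub>R h x))" for k
    unfolding h bounded_iff by blast
qed

section \<open>Gaussians and Fourier inversion\<close>

lemma integrable_exp_neg_square_half: "integrable lborel (\<lambda>x::real. exp (- x\<^sup>2 / 2))"
proof -
  have "integrable lborel (\<lambda>x. sqrt (2 * pi) * std_normal_density x)"
    by (intro integrable_mult_right integrable_normal_density) simp
  then show ?thesis by (simp add: std_normal_density_def)
qed

text \<open>This is the characteristic function of the standard normal distribution, freed from the
  normalisation 1 / sqrt(2 pi) of its density.\<close>

lemma fourier_exp_neg_square_half:
  "fourier (\<lambda>x. of_real (exp (- x\<^sup>2 / 2))) t = of_real (sqrt (2 * pi) * exp (- t\<^sup>2 / 2))"
proof -
  have "of_real (exp (- t\<^sup>2 / 2)) = char std_normal_distribution t"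
    by (simp add: char_std_normal_distribution)
  also have "\<dots> = (LINT x|lborel. std_normal_density x *\<^sub>R exp (\<i> * of_real (t * x)))"
    unfolding char_def by (subst integral_density) auto
  also have "\<dots> = (LINT x|lborel. of_real (1 / sqrt (2 * pi)) * (exp (\<i> * of_real (t * x)) * of_real (exp (- x\<^sup>2 / 2))))"
    by (intro Bochner_Integration.integral_cong) (simp_all add: std_normal_density_def scaleR_conv_of_real)
  also have "\<dots> = of_real (1 / sqrt (2 * pi)) * fourier (\<lambda>x. of_real (exp (- x\<^sup>2 / 2))) t"
    unfolding fourier_def by (rule integral_mult_right_zero)
  finally show ?thesis by (simp add: field_simps)
qed

lemma integral_exp_neg_square_half: "(LINT x|lborel. complex_of_real (exp (- x\<^sup>2 / 2))) = of_real (sqrt (2 * pi))"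
  using fourier_exp_neg_square_half[of 0] by (simp add: fourier_def)

text \<open>
  The Gaussians \<open>exp (- (y / k)\<^sup>2 / 2)\<close> tend to \<open>1\<close> while their Fourier transforms concentrate
  at \<open>0\<close>; the multiplication formula moves the transform from one factor to the other.
\<close>

lemma fourier_fourier:
  assumes f: "f \<in> schwartz"
  shows "fourier (fourier f) x = of_real (2 * pi) * f (- x)"
proof -
  define \<kappa> where "\<kappa> = (\<lambda>n. real (Suc n))"
  define G where "G = (\<lambda>y. complex_of_real (exp (- y\<^sup>2 / 2)))"
  \<comment> \<open>The modulation by exp(i x y) shifts the point where the transforms concentrate
    from 0 to \<open>- x\<close>.\<close>
  define g where "g = (\<lambda>n y. exp (\<i> * of_real (x * y)) * G (y / \<kappa> n))"
  have \<kappa>: "\<kappa> n > 0" for n by (simp add: \<kappa>_def)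
  have [measurable]: "G \<in> borel_measurable borel" unfolding G_def by measurable
  have Gint: "integrable lborel G" unfolding G_def by (intro integrable_of_real integrable_exp_neg_square_half)
  note [measurable] = schwartz_borel_measurable[OF f] schwartz_borel_measurable[OF fourier_schwartz[OF f]]
  have lim\<kappa>: "(\<lambda>n. inverse (\<kappa> n)) \<longlonglongrightarrow> 0"
    unfolding \<kappa>_def by (rule LIMSEQ_inverse_real_of_nat)
  have gint: "integrable lborel (g n)" for n
    unfolding g_def
    using lborel_integrable_real_affine[OF Gint, of "inverse (\<kappa> n)" 0] \<kappa>[of n]
    by (intro integrable_iexp_mult) (simp add: divide_inverse mult.commute)
  have Fg: "fourier (g n) z = of_real (\<kappa> n * sqrt (2 * pi)) * G (\<kappa> n * (z + x))" for n z
  proof -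
    have "fourier (g n) z = (LINT y|lborel. exp (\<i> * of_real ((z + x) * y)) * G (y / \<kappa> n))"
      unfolding fourier_def g_def mult.assoc[symmetric] exp_add[symmetric]
      by (simp add: algebra_simps)
    also have "\<dots> = \<bar>\<kappa> n\<bar> *\<^sub>R (LINT y|lborel. exp (\<i> * of_real ((z + x) * (0 + \<kappa> n * y))) * G ((0 + \<kappa> n * y) / \<kappa> n))"
      using \<kappa>[of n] by (intro lborel_integral_real_affine) simp
    also have "\<dots> = \<kappa> n *\<^sub>R fourier G (\<kappa> n * (z + x))"
      using \<kappa>[of n] by (simp add: fourier_def mult_ac)
    also have "\<dots> = of_real (\<kappa> n * sqrt (2 * pi)) * G (\<kappa> n * (z + x))"
      unfolding G_def fourier_exp_neg_square_half by (simp add: scaleR_conv_of_real)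
    finally show ?thesis .
  qed
  have lim1: "(\<lambda>n. LINT y|lborel. g n y * fourier f y) \<longlonglongrightarrow> (LINT y|lborel. exp (\<i> * of_real (x * y)) * fourier f y)"
  proof (rule integral_dominated_convergence[where w = "\<lambda>y. norm (fourier f y)"])
    show "AE y in lborel. (\<lambda>n. g n y * fourier f y) \<longlonglongrightarrow> exp (\<i> * of_real (x * y)) * fourier f y"
    proof (intro AE_I2)
      fix y :: real
      have "(\<lambda>n. y / \<kappa> n) \<longlonglongrightarrow> 0"
        using tendsto_mult[OF tendsto_const lim\<kappa>, of y] by (simp add: divide_inverse)
      then have "(\<lambda>n. g n y * fourier f y) \<longlonglongrightarrow>
          exp (\<i> * of_real (x * y)) * complex_of_real (exp (- 0\<^sup>2 / 2)) * fourier f y"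
        unfolding g_def G_def by (intro tendsto_intros) simp_all
      then show "(\<lambda>n. g n y * fourier f y) \<longlonglongrightarrow> exp (\<i> * of_real (x * y)) * fourier f y"
        by simp
    qed
    show "AE y in lborel. norm (g n y * fourier f y) \<le> norm (fourier f y)" for n
      by (intro AE_I2) (simp add: g_def G_def norm_mult mult_left_le_one_le)
    show "integrable lborel (\<lambda>y. norm (fourier f y))"
      by (intro integrable_norm schwartz_integrable fourier_schwartz f)
  qed (simp_all add: g_def)
  have eq: "(LINT y|lborel. g n y * fourier f y) =
      of_real (sqrt (2 * pi)) * (LINT w|lborel. G w * f (- x + w * inverse (\<kappa> n)))" for n
  proof -
    have "(LINT y|lborel. g n y * fourier f y) = (LINT z|lborel. of_real (\<kappa> n * sqrt (2 * pi)) * G (\<kappa> n * (z + x)) * f z)"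
      unfolding fourier_multiplication[OF gint schwartz_integrable[OF f]] Fg ..
    \<comment> \<open>Substituting z = -x + w / \<kappa> fixes the Gaussian and puts the
      concentration into the argument of \<open>f\<close>; the Jacobian cancels the factor
      \<kappa>.\<close>
    also have "\<dots> = \<bar>inverse (\<kappa> n)\<bar> *\<^sub>R (LINT w|lborel. of_real (\<kappa> n * sqrt (2 * pi))
        * G (\<kappa> n * ((- x + inverse (\<kappa> n) * w) + x)) * f (- x + inverse (\<kappa> n) * w))"
      using \<kappa>[of n] by (intro lborel_integral_real_affine) simp
    also have "\<dots> = \<bar>inverse (\<kappa> n)\<bar> *\<^sub>R (LINT w|lborel. of_real (\<kappa> n * sqrt (2 * pi)) * (G w * f (- x + w * inverse (\<kappa> n))))"
      using \<kappa>[of n] by (simp add: algebra_simps)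
    also have "\<dots> = of_real (sqrt (2 * pi)) * (LINT w|lborel. G w * f (- x + w * inverse (\<kappa> n)))"
      unfolding integral_mult_right_zero using \<kappa>[of n] by (simp add: scaleR_conv_of_real)
    finally show ?thesis .
  qed
  have lim2: "(\<lambda>n. LINT w|lborel. G w * f (- x + w * inverse (\<kappa> n))) \<longlonglongrightarrow> (LINT w|lborel. G w * f (- x))"
  proof -
    obtain B where B: "\<And>x. norm (f x) \<le> B"
      using schwartz_bounded[OF f, of 0] by (auto simp: bounded_iff)
    show ?thesis
    proof (rule integral_dominated_convergence[where w = "\<lambda>w. exp (- w\<^sup>2 / 2) * B"])
      show "AE w in lborel. (\<lambda>n. G w * f (- x + w * inverse (\<kappa> n))) \<longlonglongrightarrow> G w * f (- x)"
      proof (intro AE_I2 tendsto_mult tendsto_const)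
        fix w
        have "isCont f (- x)" 
          using schwartz_continuous_on[OF f, of UNIV] by (simp add: continuous_on_eq_continuous_at)
        moreover have "(\<lambda>n. - x + w * inverse (\<kappa> n)) \<longlonglongrightarrow> - x + w * 0"
          by (intro tendsto_intros lim\<kappa>)
        then have "(\<lambda>n. - x + w * inverse (\<kappa> n)) \<longlonglongrightarrow> - x" by simp
        ultimately show "(\<lambda>n. f (- x + w * inverse (\<kappa> n))) \<longlonglongrightarrow> f (- x)"
          by (rule isCont_tendsto_compose)
      qed
      show "AE w in lborel. norm (G w * f (- x + w * inverse (\<kappa> n))) \<le> exp (- w\<^sup>2 / 2) * B" for n
        by (intro AE_I2) (simp add: G_def norm_mult B)
      show "integrable lborel (\<lambda>w. exp (- w\<^sup>2 / 2) * B)"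
        by (intro integrable_mult_left integrable_exp_neg_square_half)
    qed simp_all
  qed
  have "(LINT y|lborel. exp (\<i> * of_real (x * y)) * fourier f y) =
      of_real (sqrt (2 * pi)) * (LINT w|lborel. G w * f (- x))"
    using LIMSEQ_unique[OF lim1[unfolded eq] tendsto_mult_left[OF lim2]] .
  \<comment> \<open>One root comes from the transform of the Gaussian, the other from its
    integral.\<close>
  also have "\<dots> = of_real (sqrt (2 * pi)) * of_real (sqrt (2 * pi)) * f (- x)"
    unfolding G_def integral_mult_left_zero integral_exp_neg_square_half by simp
  also have "\<dots> = of_real (2 * pi) * f (- x)"
    unfolding of_real_mult[symmetric] real_sqrt_mult_self by simp
  finally show ?thesis by (simp add: fourier_def)
qed

section \<open>Oscillatory integrals\<close>

text \<open>The first-derivative test of van der Corput. Write cos p = (1 / p') (p' cos p): the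
  second factor is the derivative of sin p, so its integrals are at most 2, and the first is
  monotone with values in (0, 1/d]. The second mean value theorem yields two terms, each at most
  2/d.\<close>

lemma integral_cos_phase_bound:
  fixes p p' :: "real \<Rightarrow> real"
  assumes "a \<le> b" and d: "d > 0" "d \<le> p' a"
    and deriv: "\<And>s. s \<in> {a..b} \<Longrightarrow> (p has_real_derivative p' s) (at s)"
    and mono: "\<And>s t. a \<le> s \<Longrightarrow> s \<le> t \<Longrightarrow> t \<le> b \<Longrightarrow> p' s \<le> p' t"
  shows "\<bar>integral {a..b} (\<lambda>s. cos (p s))\<bar> \<le> 4 / d"
proof -
  define h where "h = (\<lambda>s. p' s * cos (p s))"
  \<comment> \<open>The sign makes the amplitude increasing, as the second mean value theorem asks;
    it is undone when the integral is rewritten.\<close>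
  define g where "g = (\<lambda>s. - inverse (p' s))"
  have pos: "p' s \<ge> d" if "s \<in> {a..b}" for s
    using d mono[of a s] that by auto
  have ftc: "(h has_integral (sin (p v) - sin (p u))) {u..v}" if "a \<le> u" "u \<le> v" "v \<le> b" for u v
    unfolding h_def
  proof (rule fundamental_theorem_of_calculus[OF \<open>u \<le> v\<close>])
    fix s assume "s \<in> {u..v}"
    then have "(p has_real_derivative p' s) (at s within {u..v})"
      using deriv that by (auto intro: has_field_derivative_at_within)
    then show "((\<lambda>s. sin (p s)) has_vector_derivative p' s * cos (p s)) (at s within {u..v})"
      unfolding has_real_derivative_iff_has_vector_derivative[symmetric]
      by (auto intro!: derivative_eq_intros)
  qed
  have small: "\<bar>integral {u..v} h\<bar> \<le> 2" if "a \<le> u" "u \<le> v" "v \<le> b" for u v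
    using integral_unique[OF ftc[OF that]] abs_sin_le_one[of "p u"] abs_sin_le_one[of "p v"] by linarith
  have "h integrable_on {a..b}"
    using ftc[of a b] \<open>a \<le> b\<close> by (auto simp: integrable_on_def)
  moreover have "g s \<le> g t" if "a \<le> s" "s \<le> t" "t \<le> b" for s t
    using mono[OF that] pos[of s] d that by (auto simp: g_def intro!: le_imp_inverse_le)
  ultimately obtain c where c: "c \<in> {a..b}"
    and eq: "integral {a..b} (\<lambda>s. g s * h s) = g a * integral {a..c} h + g b * integral {c..b} h"
    using second_mean_value_theorem[of h a b g] \<open>a \<le> b\<close> by metis
  have "integral {a..b} (\<lambda>s. cos (p s)) = - integral {a..b} (\<lambda>s. g s * h s)"
    unfolding integral_neg[symmetric]
  proof (rule integral_cong)
    fix s assume "s \<in> {a..b}"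
    then have "p' s \<noteq> 0" using pos[of s] d by auto
    then show "cos (p s) = - (g s * h s)" by (simp add: g_def h_def)
  qed
  also have "\<bar>\<dots>\<bar> \<le> \<bar>g a\<bar> * \<bar>integral {a..c} h\<bar> + \<bar>g b\<bar> * \<bar>integral {c..b} h\<bar>"
    unfolding eq abs_minus abs_mult[symmetric] by (rule abs_triangle_ineq)
  also have "\<dots> \<le> (1 / d) * 2 + (1 / d) * 2"
    using pos[of a] pos[of b] d \<open>a \<le> b\<close> c
    by (intro add_mono mult_mono small) (auto simp: g_def field_simps)
  finally show ?thesis by simp
qed

section \<open>Convergence and growth of the truncated Airy integrals\<close>

definition airy_partial :: "real \<Rightarrow> real \<Rightarrow> real \<Rightarrow> real" where
  "airy_partial \<alpha> R y = integral {0..R} (\<lambda>s. cos (s * y + s powr \<alpha> / \<alpha>))"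

lemma continuous_on_airy_integrand:
  fixes \<alpha> a y :: real
  assumes "\<alpha> > 1" "a \<ge> 0"
  shows "continuous_on {a..b} (\<lambda>s. cos (s * y + s powr \<alpha> / \<alpha>))"
proof -
  have "continuous_on {a..b} (\<lambda>s. s powr \<alpha>)"
    by (rule continuous_on_powr') (use assms in \<open>auto intro: continuous_intros\<close>)
  then show ?thesis
    using assms
    by (intro continuous_on_cos continuous_on_add continuous_on_mult continuous_on_divide
        continuous_on_id continuous_on_const) auto
qed

lemma airy_integrand_integrable:
  fixes \<alpha> a y :: real
  assumes "\<alpha> > 1" "a \<ge> 0"
  shows "(\<lambda>s. cos (s * y + s powr \<alpha> / \<alpha>)) integrable_on {a..b}"
  using continuous_on_airy_integrand[OF assms] by (rule integrable_continuous_real)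

text \<open>The threshold for \<open>a\<close> says that a^(\<alpha> - 1) is at least |y| + d. From
  there on the phase derivative y + s^(\<alpha> - 1) is at least \<open>d\<close>, whatever the sign
  of \<open>y\<close>.\<close>

lemma airy_tail_bound:
  assumes \<alpha>: "\<alpha> > 1" and d: "d > 0" and a: "(\<bar>y\<bar> + d) powr (1 / (\<alpha> - 1)) \<le> a" and "a \<le> b"
  shows "\<bar>airy_partial \<alpha> b y - airy_partial \<alpha> a y\<bar> \<le> 4 / d"
proof -
  have "0 < (\<bar>y\<bar> + d) powr (1 / (\<alpha> - 1))" using d by simp
  with a have a0: "a > 0" by linarith
  have "airy_partial \<alpha> a y + integral {a..b} (\<lambda>s. cos (s * y + s powr \<alpha> / \<alpha>)) = airy_partial \<alpha> b y"
    unfolding airy_partial_def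
    using a0 \<open>a \<le> b\<close> \<alpha>
    by (intro Henstock_Kurzweil_Integration.integral_combine airy_integrand_integrable) auto
  moreover have "\<bar>integral {a..b} (\<lambda>s. cos (s * y + s powr \<alpha> / \<alpha>))\<bar> \<le> 4 / d"
  proof (rule integral_cos_phase_bound[OF \<open>a \<le> b\<close> d, where p' = "\<lambda>s. y + s powr (\<alpha> - 1)"])
    have "\<bar>y\<bar> + d = ((\<bar>y\<bar> + d) powr (1 / (\<alpha> - 1))) powr (\<alpha> - 1)"
      using \<alpha> d by (simp add: powr_powr)
    also have "\<dots> \<le> a powr (\<alpha> - 1)"
      using \<alpha> a by (intro powr_mono2) auto
    finally show "d \<le> y + a powr (\<alpha> - 1)" by linarith
  next
    fix s assume "s \<in> {a..b}"
    then show "((\<lambda>s. s * y + s powr \<alpha> / \<alpha>) has_real_derivative y + s powr (\<alpha> - 1)) (at s)"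
      using a0 \<alpha> by (auto intro!: derivative_eq_intros)
  next
    fix s t assume "a \<le> s" "s \<le> t"
    then show "y + s powr (\<alpha> - 1) \<le> y + t powr (\<alpha> - 1)"
      using a0 \<alpha> by (intro add_left_mono powr_mono2) auto
  qed
  ultimately show ?thesis by linarith
qed

text \<open>This makes the \<open>Lim\<close> in \<open>airy\<close> a genuine limit. The tail bound
  4/d gets small as \<open>d\<close> grows; completeness provides the limit along the integers, and
  the same tail bound extends it to real cut-offs.\<close>

lemma airy_partial_tendsto:
  assumes \<alpha>: "\<alpha> > 1"
  shows "((\<lambda>R. airy_partial \<alpha> R y) \<longlongrightarrow> pi * airy \<alpha> y) at_top"
proof -
  define s0 where "s0 = (\<lambda>d. (\<bar>y\<bar> + d) powr (1 / (\<alpha> - 1)))"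
  have tail: "\<bar>airy_partial \<alpha> b y - airy_partial \<alpha> a y\<bar> \<le> 4 / d" if "d > 0" "s0 d \<le> a" "s0 d \<le> b" for a b d
    using airy_tail_bound[OF \<alpha>, of d y a b] airy_tail_bound[OF \<alpha>, of d y b a] that
    by (cases "a \<le> b") (auto simp: s0_def abs_minus_commute)
  have "Cauchy (\<lambda>n. airy_partial \<alpha> (real n) y)"
  proof (rule metric_CauchyI)
    fix e :: real assume "e > 0"
    \<comment> \<open>With d = 8/e the tail bound 4/d equals e/2.\<close>
    then have d: "8 / e > 0" by simp
    obtain N :: nat where N: "s0 (8 / e) \<le> real N" using real_arch_simple by blast
    show "\<exists>N. \<forall>m\<ge>N. \<forall>n\<ge>N. dist (airy_partial \<alpha> (real m) y) (airy_partial \<alpha> (real n) y) < e"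
    proof (intro exI allI impI)
      fix m n assume "N \<le> m" "N \<le> n"
      then have "\<bar>airy_partial \<alpha> (real m) y - airy_partial \<alpha> (real n) y\<bar> \<le> 4 / (8 / e)"
        using N by (intro tail[OF d]) auto
      also have "\<dots> < e" using \<open>e > 0\<close> by simp
      finally show "dist (airy_partial \<alpha> (real m) y) (airy_partial \<alpha> (real n) y) < e"
        by (simp add: dist_real_def)
    qed
  qed
  then obtain L where L: "(\<lambda>n. airy_partial \<alpha> (real n) y) \<longlonglongrightarrow> L"
    unfolding Cauchy_convergent_iff convergent_def by blast
  have lim: "((\<lambda>R. airy_partial \<alpha> R y) \<longlongrightarrow> L) at_top"
  proof (rule tendstoI)
    fix e :: real assume "e > 0"
    then have d: "8 / e > 0" by simp
    have "\<bar>airy_partial \<alpha> R y - L\<bar> < e" if "R \<ge> s0 (8 / e)" for R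
    proof -
      have "(\<lambda>n. \<bar>airy_partial \<alpha> R y - airy_partial \<alpha> (real n) y\<bar>) \<longlonglongrightarrow> \<bar>airy_partial \<alpha> R y - L\<bar>"
        by (intro tendsto_intros L)
      moreover have "eventually (\<lambda>n. \<bar>airy_partial \<alpha> R y - airy_partial \<alpha> (real n) y\<bar> \<le> 4 / (8 / e)) sequentially"
        using eventually_ge_at_top[of "nat \<lceil>s0 (8 / e)\<rceil>"]
      proof eventually_elim
        case (elim n)
        then have "s0 (8 / e) \<le> real n" by linarith
        then show ?case using that by (intro tail[OF d])
      qed
      ultimately have "\<bar>airy_partial \<alpha> R y - L\<bar> \<le> 4 / (8 / e)"
        by (intro tendsto_upperbound) auto
      also have "\<dots> < e" using \<open>e > 0\<close> by simp
      finally show ?thesis .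
    qed
    then show "eventually (\<lambda>R. dist (airy_partial \<alpha> R y) L < e) at_top"
      unfolding dist_real_def by (auto simp: eventually_at_top_linorder)
  qed
  have "airy \<alpha> y = 1 / pi * L"
    unfolding airy_def
    using tendsto_Lim[OF trivial_limit_at_top_linorder lim] by (simp add: airy_partial_def)
  with lim show ?thesis by simp
qed

text \<open>Split at the threshold for d = 1. Up to it the integrand is at most 1 in modulus, so the
  integral is at most \<open>s0 y\<close>; beyond it the tail adds at most 4. The threshold grows
  polynomially, with exponent 1 / (\<alpha> - 1) rounded up.\<close>

lemma airy_partial_bound:
  assumes \<alpha>: "\<alpha> > 1"
  obtains C m where "C \<ge> 0" "\<And>R y. R \<ge> 0 \<Longrightarrow> \<bar>airy_partial \<alpha> R y\<bar> \<le> C * (1 + y\<^sup>2) ^ m"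
proof -
  define m where "m = nat \<lceil>1 / (\<alpha> - 1)\<rceil>"
  define s0 where "s0 = (\<lambda>y. (\<bar>y\<bar> + 1) powr (1 / (\<alpha> - 1)))"
  have small: "\<bar>airy_partial \<alpha> R y\<bar> \<le> R" if "R \<ge> 0" for R y
    using integral_bound[of 0 R "\<lambda>s. cos (s * y + s powr \<alpha> / \<alpha>)" 1] that
      continuous_on_airy_integrand[OF \<alpha>]
    unfolding airy_partial_def by simp
  have s0: "s0 y \<le> 2 ^ m * (1 + y\<^sup>2) ^ m" for y
  proof -
    have "s0 y \<le> (\<bar>y\<bar> + 1) powr real m"
      unfolding s0_def m_def by (intro powr_mono) linarith+
    also have "\<dots> = (\<bar>y\<bar> + 1) ^ m" by (intro powr_realpow) linarith
    also have "\<dots> \<le> (2 * (1 + y\<^sup>2)) ^ m"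
    proof (intro power_mono)
      have "0 \<le> (\<bar>y\<bar> - 1)\<^sup>2" by simp
      then have "2 * \<bar>y\<bar> \<le> 1 + y\<^sup>2" by (simp add: power2_diff)
      then show "\<bar>y\<bar> + 1 \<le> 2 * (1 + y\<^sup>2)" by (smt (verit) zero_le_power2)
    qed simp
    also have "\<dots> = 2 ^ m * (1 + y\<^sup>2) ^ m" by (rule power_mult_distrib)
    finally show ?thesis .
  qed
  have "\<bar>airy_partial \<alpha> R y\<bar> \<le> (2 ^ m + 4) * (1 + y\<^sup>2) ^ m" if "R \<ge> 0" for R y
  proof -
    have "s0 y \<ge> 0" by (simp add: s0_def)
    have "\<bar>airy_partial \<alpha> R y\<bar> \<le> s0 y + 4"
    proof (cases "R \<le> s0 y")
      case True
      then show ?thesis using small[OF that, of y] by linarith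
    next
      case False
      then have "\<bar>airy_partial \<alpha> R y - airy_partial \<alpha> (s0 y) y\<bar> \<le> 4"
        using airy_tail_bound[OF \<alpha>, of 1 y "s0 y" R] by (simp add: s0_def)
      then show ?thesis using small[OF \<open>s0 y \<ge> 0\<close>, of y] by linarith
    qed
    moreover have "1 \<le> (1 + y\<^sup>2) ^ m" by (rule one_le_power) simp
    ultimately show ?thesis using s0[of y] unfolding distrib_right by linarith
  qed
  then show ?thesis by (intro that[of "2 ^ m + 4" m]) auto
qed

section \<open>The fundamental solution\<close>

text \<open>Continuity rests on two seminorms without derivatives, of orders 0 and 2 (m + 1).
  Together they control the weight (1 + x^2)^(m + 1), one power more than the growth of
  \<open>f\<close>.\<close>

lemma tempered_distribution_poly_bounded:
  fixes f :: "real \<Rightarrow> complex"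
  assumes [measurable]: "f \<in> borel_measurable borel" and f: "\<And>x. norm (f x) \<le> C * (1 + x\<^sup>2) ^ m"
  shows "tempered_distribution (\<lambda>\<phi>. LINT x|lborel. f x * \<phi> x)"
  unfolding tempered_distribution_def
proof (intro conjI ballI allI impI)
  fix \<phi> \<psi> a b assume "\<phi> \<in> schwartz" "\<psi> \<in> schwartz"
  then have int: "integrable lborel (\<lambda>x. f x * \<phi> x)" "integrable lborel (\<lambda>x. f x * \<psi> x)"
    by (auto intro: schwartz_integrable_poly_mult f)
  have "(LINT x|lborel. f x * (a * \<phi> x + b * \<psi> x)) =
      (LINT x|lborel. a * (f x * \<phi> x) + b * (f x * \<psi> x))"
    by (simp add: algebra_simps)
  also have "\<dots> = a * (LINT x|lborel. f x * \<phi> x) + b * (LINT x|lborel. f x * \<psi> x)"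
    using int by simp
  finally show "(LINT x|lborel. f x * (a * \<phi> x + b * \<psi> x)) =
      a * (LINT x|lborel. f x * \<phi> x) + b * (LINT x|lborel. f x * \<psi> x)" .
next
  fix \<Phi> \<phi> assume \<phi>: "\<phi> \<in> schwartz" and \<Phi>: "\<forall>j. \<Phi> j \<in> schwartz" and lim: "schwartz_tendsto \<Phi> \<phi>"
  have C: "0 \<le> C" using order_trans[OF norm_ge_zero f[of 0]] by simp
  have int: "integrable lborel (\<lambda>x. f x * \<phi> x)" "\<And>j. integrable lborel (\<lambda>x. f x * \<Phi> j x)"
    using \<phi> \<Phi> by (auto intro: schwartz_integrable_poly_mult f)
  have unif: "uniform_limit UNIV (\<lambda>j x. x ^ k *\<^sub>R \<Phi> j x) (\<lambda>x. x ^ k *\<^sub>R \<phi> x) sequentially" for k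
    using lim[unfolded schwartz_tendsto_def, rule_format, of k 0] by (simp only: nth_deriv_0)
  \<comment> \<open>The power of 2 comes from \<open>one_plus_square_power_le\<close>, the further
    factor 2 from adding the two seminorms.\<close>
  define M where "M = C * 2 ^ Suc m * 2 * (LINT x|lborel. inverse (1 + x\<^sup>2))"
  have diff: "norm ((LINT x|lborel. f x * \<Phi> j x) - (LINT x|lborel. f x * \<phi> x)) \<le> M * e"
    if e: "e > 0" and 0: "\<And>x. dist (x ^ 0 *\<^sub>R \<Phi> j x) (x ^ 0 *\<^sub>R \<phi> x) < e"
      and k: "\<And>x. dist (x ^ (2 * Suc m) *\<^sub>R \<Phi> j x) (x ^ (2 * Suc m) *\<^sub>R \<phi> x) < e" for j e
  proof -
    have "norm (f x * (\<Phi> j x - \<phi> x)) \<le> C * 2 ^ Suc m * 2 * e * inverse (1 + x\<^sup>2)" for x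
    proof -
      have pos: "1 + x\<^sup>2 > 0" by (simp add: add_pos_nonneg)
      define D where "D = norm (\<Phi> j x - \<phi> x)"
      have "x ^ (2 * Suc m) * D \<le> \<bar>x ^ (2 * Suc m)\<bar> * D"
        by (intro mult_right_mono abs_ge_self) (simp add: D_def)
      also have "\<dots> = dist (x ^ (2 * Suc m) *\<^sub>R \<Phi> j x) (x ^ (2 * Suc m) *\<^sub>R \<phi> x)"
        by (simp only: D_def dist_norm scaleR_diff_right[symmetric] norm_scaleR)
      finally have D: "D \<le> e" "x ^ (2 * Suc m) * D \<le> e"
        using 0[of x] k[of x] by (simp_all add: D_def dist_norm)
      have "(1 + x\<^sup>2) ^ Suc m * D \<le> (2 ^ Suc m * (1 + x ^ (2 * Suc m))) * D"
        by (intro mult_right_mono one_plus_square_power_le) (simp add: D_def)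
      also have "\<dots> = 2 ^ Suc m * (D + x ^ (2 * Suc m) * D)" by (simp only: algebra_simps)
      also have "\<dots> \<le> 2 ^ Suc m * (e + e)"
        using D by (intro mult_left_mono add_mono) auto
      finally have bd: "(1 + x\<^sup>2) ^ Suc m * D \<le> 2 ^ Suc m * (e + e)" .
      have "norm (f x * (\<Phi> j x - \<phi> x)) \<le> (C * (1 + x\<^sup>2) ^ m) * D"
        unfolding norm_mult D_def by (intro mult_right_mono f) simp
      also have "\<dots> = C * ((1 + x\<^sup>2) ^ Suc m * D) * inverse (1 + x\<^sup>2)"
        using pos by (simp add: field_simps)
      also have "\<dots> \<le> C * (2 ^ Suc m * (e + e)) * inverse (1 + x\<^sup>2)"
        using pos C bd by (intro mult_right_mono mult_left_mono) auto
      finally show ?thesis by (simp add: mult_ac)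
    qed
    moreover have "integrable lborel (\<lambda>x. f x * (\<Phi> j x - \<phi> x))"
      using int by (simp add: right_diff_distrib)
    moreover have "integrable lborel (\<lambda>x::real. C * 2 ^ Suc m * 2 * e * inverse (1 + x\<^sup>2))"
      by (intro integrable_mult_right integrable_inverse_one_plus_square)
    ultimately have "norm (LINT x|lborel. f x * (\<Phi> j x - \<phi> x)) \<le>
        (LINT x|lborel. C * 2 ^ Suc m * 2 * e * inverse (1 + x\<^sup>2))"
      by (intro Bochner_Integration.integral_norm_bound_integral) auto
    then show ?thesis using int by (simp add: right_diff_distrib M_def mult_ac)
  qed
  have M: "M \<ge> 0"
    unfolding M_def using C by (intro mult_nonneg_nonneg integral_nonneg_AE AE_I2) auto
  show "(\<lambda>j. LINT x|lborel. f x * \<Phi> j x) \<longlonglongrightarrow> (LINT x|lborel. f x * \<phi> x)"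
  proof (rule tendstoI)
    fix e :: real assume "e > 0"
    \<comment> \<open>The denominator is \<open>M + 1\<close> because \<open>M\<close> may be
      0.\<close>
    define e' where "e' = e / (M + 1)"
    have e': "e' > 0" "M * e' < e" using \<open>e > 0\<close> M by (auto simp: e'_def field_simps)
    show "\<forall>\<^sub>F j in sequentially. dist (LINT x|lborel. f x * \<Phi> j x) (LINT x|lborel. f x * \<phi> x) < e"
      using uniform_limitD[OF unif[of 0] e'(1)] uniform_limitD[OF unif[of "2 * Suc m"] e'(1)]
    proof eventually_elim
      case (elim j)
      have "norm ((LINT x|lborel. f x * \<Phi> j x) - (LINT x|lborel. f x * \<phi> x)) \<le> M * e'"
        by (rule diff[OF e'(1)]) (use elim in blast)+
      then show ?case using e'(2) unfolding dist_norm by linarith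
    qed
  qed
qed

section \<open>The wave kernel as a limit of truncated kernels\<close>

definition wave_symbol :: "real \<Rightarrow> real \<Rightarrow> real \<Rightarrow> complex" where
  "wave_symbol \<alpha> t \<gamma> = of_real (cos (\<bar>\<gamma>\<bar> powr \<alpha> * t))"

definition wave_kernel :: "real \<Rightarrow> real \<Rightarrow> real \<Rightarrow> complex" where
  "wave_kernel \<alpha> t x = complex_of_real (1 / (2 * (\<alpha> * t) powr (1 / \<alpha>)) *
     (airy \<alpha> (x / (\<alpha> * t) powr (1 / \<alpha>)) + airy \<alpha> (- (x / (\<alpha> * t) powr (1 / \<alpha>)))))"

lemma wave_symbol_measurable [measurable]: "wave_symbol \<alpha> t \<in> borel_measurable borel"
  unfolding wave_symbol_def by measurable

lemma norm_wave_symbol_le: "norm (wave_symbol \<alpha> t \<gamma>) \<le> 1"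
  by (simp add: wave_symbol_def)

lemma airy_partial_scale:
  assumes "c > 0" "n \<ge> 0"
  shows "airy_partial \<alpha> (c * n) z = c * integral {0..n} (\<lambda>y. cos (c * y * z + (c * y) powr \<alpha> / \<alpha>))"
proof -
  have "(\<lambda>x. x / c) ` {0..c * n} = {0..n}"
  proof (intro equalityI subsetI)
    fix x assume "x \<in> {0..n}"
    then show "x \<in> (\<lambda>x. x / c) ` {0..c * n}"
      using assms by (intro image_eqI[of _ _ "c * x"]) auto
  qed (use assms in \<open>auto simp: field_simps\<close>)
  then show ?thesis
    using integral_stretch_real[of c 0 "c * n" "\<lambda>s. cos (s * z + s powr \<alpha> / \<alpha>)"] assms
    by (simp add: airy_partial_def field_simps)
qed

text \<open>The scale satisfies c^\<alpha> = \<alpha> t, so s = c y turns y^\<alpha> t into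
  s^\<alpha> / \<alpha> and x y into s (x / c), with Jacobian 1/c. Folding the negative half-line
  onto the positive one leaves a product of cosines, which splits into the two Airy phases.\<close>

lemma fourier_truncated_wave_symbol:
  assumes \<alpha>: "\<alpha> > 1" and t: "t > 0" and n: "n \<ge> 0"
  defines "c \<equiv> (\<alpha> * t) powr (1 / \<alpha>)"
  shows "fourier (\<lambda>\<gamma>. indicator {-n..n} \<gamma> *\<^sub>R wave_symbol \<alpha> t \<gamma>) x =
    of_real ((airy_partial \<alpha> (c * n) (x / c) + airy_partial \<alpha> (c * n) (- (x / c))) / c)"
proof -
  have c: "c > 0" using \<alpha> t by (simp add: c_def)
  have c\<alpha>: "c powr \<alpha> = \<alpha> * t" using \<alpha> t by (simp add: c_def powr_powr)
  define q where "q = (\<lambda>y::real. \<bar>y\<bar> powr \<alpha> * t)"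
  define h where "h = (\<lambda>y. exp (\<i> * of_real (x * y)) * complex_of_real (cos (q y)))"
  have "continuous_on A (\<lambda>y::real. \<bar>y\<bar> powr \<alpha>)" for A
    by (rule continuous_on_powr') (use \<alpha> in \<open>auto intro: continuous_intros\<close>)
  then have qcont: "continuous_on A q" for A
    unfolding q_def by (intro continuous_on_mult continuous_on_const)
  then have hcont: "continuous_on A h" for A
    unfolding h_def by (intro continuous_intros)
  have "fourier (\<lambda>\<gamma>. indicator {-n..n} \<gamma> *\<^sub>R wave_symbol \<alpha> t \<gamma>) x = (LINT y:{-n..n}|lborel. h y)"
    unfolding fourier_def set_lebesgue_integral_def
    by (simp add: h_def q_def wave_symbol_def)
  also have "\<dots> = integral {-n..n} h"
    by (intro set_borel_integral_eq_integral borel_integrable_atLeastAtMost' hcont)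
  also have "\<dots> = integral {-n..0} h + integral {0..n} h"
    using n by (intro Henstock_Kurzweil_Integration.integral_combine[symmetric]
        integrable_continuous_real hcont) auto
  also have "integral {-n..0} h = integral {0..n} (\<lambda>y. h (- y))"
    using Henstock_Kurzweil_Integration.integral_reflect_real[of n 0 "\<lambda>y. h (- y)"] by simp
  also have "\<dots> + integral {0..n} h = integral {0..n} (\<lambda>y. h (- y) + h y)"
    by (intro Henstock_Kurzweil_Integration.integral_add[symmetric] integrable_continuous_real
        hcont continuous_on_compose2[OF hcont[of UNIV]] continuous_intros) auto
  also have "\<dots> = integral {0..n} (\<lambda>y. complex_of_real (cos (c * y * (x / c) + (c * y) powr \<alpha> / \<alpha>)
       + cos (c * y * (- (x / c)) + (c * y) powr \<alpha> / \<alpha>)))"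
  proof (rule integral_cong)
    fix y assume y: "y \<in> {0..n}"
    then have q: "(c * y) powr \<alpha> / \<alpha> = q y"
      using c c\<alpha> \<alpha> by (simp add: powr_mult q_def)
    have "h (- y) + h y = (cis (- (x * y)) + cis (x * y)) * complex_of_real (cos (q y))"
      by (simp add: h_def cis_conv_exp q_def algebra_simps)
    also have "\<dots> = complex_of_real (2 * cos (x * y) * cos (q y))"
      by (simp add: complex_eq_iff)
    \<comment> \<open>The product-to-sum formula is the origin of the two terms with arguments x / c
      and -x / c.\<close>
    also have "2 * cos (x * y) * cos (q y) = cos (x * y + q y) + cos (- (x * y) + q y)"
      by (simp add: cos_add cos_diff mult.commute)
    finally show "h (- y) + h y = complex_of_real (cos (c * y * (x / c) + (c * y) powr \<alpha> / \<alpha>)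
       + cos (c * y * (- (x / c)) + (c * y) powr \<alpha> / \<alpha>))"
      using c unfolding q by (simp add: mult_ac)
  qed
  also have "\<dots> = of_real (integral {0..n} (\<lambda>y. cos (c * y * (x / c) + (c * y) powr \<alpha> / \<alpha>))
      + integral {0..n} (\<lambda>y. cos (c * y * (- (x / c)) + (c * y) powr \<alpha> / \<alpha>)))"
  proof -
    have int: "(\<lambda>y. cos (c * y * z + (c * y) powr \<alpha> / \<alpha>)) integrable_on {0..n}" for z
    proof (rule integrable_continuous_real)
      show "continuous_on {0..n} (\<lambda>y. cos (c * y * z + (c * y) powr \<alpha> / \<alpha>))"
        by (rule continuous_on_compose2[OF continuous_on_airy_integrand[OF \<alpha> order_refl, of "c * n" z]])
           (use c in \<open>auto intro!: continuous_intros mult_left_mono\<close>)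
    qed
    show ?thesis
      by (intro integral_unique has_integral_of_real has_integral_add integrable_integral int)
  qed
  also have "\<dots> = of_real ((airy_partial \<alpha> (c * n) (x / c) + airy_partial \<alpha> (c * n) (- (x / c))) / c)"
    unfolding airy_partial_scale[OF c n] using c by (simp add: field_simps)
  finally show ?thesis .
qed

lemma integrable_truncated_wave_symbol:
  "integrable lborel (\<lambda>\<gamma>. indicator {-n..n} \<gamma> *\<^sub>R wave_symbol \<alpha> t \<gamma>)"
proof (rule Bochner_Integration.integrable_bound)
  show "integrable lborel (\<lambda>\<gamma>::real. indicator {-n..n} \<gamma> :: real)"
    by (intro integrable_real_indicator) (auto simp: emeasure_lborel_Icc_eq)
  show "AE \<gamma> in lborel. norm (indicator {-n..n} \<gamma> *\<^sub>R wave_symbol \<alpha> t \<gamma>) \<le> norm (indicator {-n..n} \<gamma> :: real)"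
    by (intro AE_I2) (simp add: norm_wave_symbol_le indicator_def)
qed measurable

text \<open>This is the inverse Fourier transform of the truncated symbol: as that symbol is even,
  the sign in the exponent is immaterial and only the factor 1 / (2 pi) remains.\<close>

definition truncated_kernel :: "real \<Rightarrow> real \<Rightarrow> nat \<Rightarrow> real \<Rightarrow> complex" where
  "truncated_kernel \<alpha> t n x =
     fourier (\<lambda>\<gamma>. indicator {- real n..real n} \<gamma> *\<^sub>R wave_symbol \<alpha> t \<gamma>) x / of_real (2 * pi)"

lemma truncated_kernel_measurable [measurable]: "truncated_kernel \<alpha> t n \<in> borel_measurable borel"
  using fourier_borel_measurable[OF integrable_truncated_wave_symbol]
  unfolding truncated_kernel_def by measurable

lemma truncated_kernel_tendsto:
  assumes \<alpha>: "\<alpha> > 1" and t: "t > 0"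
  shows "(\<lambda>n. truncated_kernel \<alpha> t n x) \<longlonglongrightarrow> wave_kernel \<alpha> t x"
proof -
  define c where "c = (\<alpha> * t) powr (1 / \<alpha>)"
  have c: "c > 0" using \<alpha> t by (simp add: c_def)
  have "filterlim (\<lambda>n. c * real n) at_top sequentially"
    using c by (intro filterlim_tendsto_pos_mult_at_top[OF tendsto_const] filterlim_real_sequentially)
  note lim = filterlim_compose[OF airy_partial_tendsto[OF \<alpha>] this]
  have "(\<lambda>n. complex_of_real ((airy_partial \<alpha> (c * real n) (x / c) + airy_partial \<alpha> (c * real n) (- (x / c))) / c)
        / of_real (2 * pi))
      \<longlonglongrightarrow> complex_of_real ((pi * airy \<alpha> (x / c) + pi * airy \<alpha> (- (x / c))) / c) / of_real (2 * pi)"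
    using c by (intro tendsto_intros lim) auto
  \<comment> \<open>The factor pi in the limit of the partial integrals cancels against 2 pi, which
    leaves 1 / (2 c).\<close>
  also have "complex_of_real ((pi * airy \<alpha> (x / c) + pi * airy \<alpha> (- (x / c))) / c) / of_real (2 * pi)
      = wave_kernel \<alpha> t x"
    unfolding wave_kernel_def c_def[symmetric] of_real_divide[symmetric] using c
    by (intro arg_cong[of _ _ complex_of_real]) (simp add: field_simps)
  finally show ?thesis
    unfolding truncated_kernel_def
    using fourier_truncated_wave_symbol[OF \<alpha> t] by (simp add: c_def)
qed

lemma wave_kernel_measurable:
  assumes "\<alpha> > 1" "t > 0"
  shows "wave_kernel \<alpha> t \<in> borel_measurable borel"
  by (rule borel_measurable_LIMSEQ_metric[of "truncated_kernel \<alpha> t"])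
     (simp_all add: truncated_kernel_tendsto assms)

text \<open>The rescaling of the argument is absorbed by 1 + (x / c)^2 \<le> (1 + 1 / c^2) (1 +
  x^2). The constant depends on \<open>t\<close> but not on \<open>n\<close>, as dominated
  convergence requires.\<close>

lemma truncated_kernel_bound:
  assumes \<alpha>: "\<alpha> > 1" and t: "t > 0"
  obtains D m where "\<And>n x. norm (truncated_kernel \<alpha> t n x) \<le> D * (1 + x\<^sup>2) ^ m"
proof -
  define c where "c = (\<alpha> * t) powr (1 / \<alpha>)"
  have c: "c > 0" using \<alpha> t by (simp add: c_def)
  obtain C m where C: "C \<ge> 0" and bd: "\<And>R y. R \<ge> 0 \<Longrightarrow> \<bar>airy_partial \<alpha> R y\<bar> \<le> C * (1 + y\<^sup>2) ^ m"
    using airy_partial_bound[OF \<alpha>] by blast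
  have "norm (truncated_kernel \<alpha> t n x) \<le> (2 * C * (1 + 1 / c\<^sup>2) ^ m / c / (2 * pi)) * (1 + x\<^sup>2) ^ m" for n x
  proof -
    have "(1 + (x / c)\<^sup>2) ^ m \<le> ((1 + 1 / c\<^sup>2) * (1 + x\<^sup>2)) ^ m"
      using c by (intro power_mono) (auto simp: field_simps power_divide)
    also have "\<dots> = (1 + 1 / c\<^sup>2) ^ m * (1 + x\<^sup>2) ^ m" by (rule power_mult_distrib)
    finally have sq: "C * (1 + (x / c)\<^sup>2) ^ m \<le> C * ((1 + 1 / c\<^sup>2) ^ m * (1 + x\<^sup>2) ^ m)"
      using C by (rule mult_left_mono)
    let ?S = "airy_partial \<alpha> (c * real n) (x / c) + airy_partial \<alpha> (c * real n) (- (x / c))"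
    have "\<bar>?S\<bar> \<le> 2 * (C * ((1 + 1 / c\<^sup>2) ^ m * (1 + x\<^sup>2) ^ m))"
      using bd[of "c * real n" "x / c"] bd[of "c * real n" "- (x / c)"] c sq by simp
    then have "\<bar>?S\<bar> / c / (2 * pi) \<le> 2 * (C * ((1 + 1 / c\<^sup>2) ^ m * (1 + x\<^sup>2) ^ m)) / c / (2 * pi)"
      using c by (intro divide_right_mono) auto
    moreover have "norm (truncated_kernel \<alpha> t n x) = \<bar>?S\<bar> / c / (2 * pi)"
      unfolding truncated_kernel_def fourier_truncated_wave_symbol[OF \<alpha> t of_nat_0_le_iff]
        c_def[symmetric] of_real_divide[symmetric] norm_of_real using c by (simp add: abs_divide)
    ultimately show ?thesis by (simp add: mult_ac)
  qed
  then show ?thesis by (rule that)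
qed

lemma wave_kernel_bound:
  assumes "\<alpha> > 1" "t > 0"
  obtains D m where "\<And>x. norm (wave_kernel \<alpha> t x) \<le> D * (1 + x\<^sup>2) ^ m"
proof -
  obtain D m where "\<And>n x. norm (truncated_kernel \<alpha> t n x) \<le> D * (1 + x\<^sup>2) ^ m"
    using truncated_kernel_bound[OF assms] by blast
  then have "norm (wave_kernel \<alpha> t x) \<le> D * (1 + x\<^sup>2) ^ m" for x
    by (intro tendsto_upperbound[OF tendsto_norm[OF truncated_kernel_tendsto[OF assms]]]) auto
  then show ?thesis by (rule that)
qed

lemma integrable_wave_kernel_mult:
  assumes "\<alpha> > 1" "t > 0" "f \<in> schwartz"
  shows "integrable lborel (\<lambda>x. wave_kernel \<alpha> t x * f x)"
proof -
  obtain D m where "\<And>x. norm (wave_kernel \<alpha> t x) \<le> D * (1 + x\<^sup>2) ^ m"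
    using wave_kernel_bound[OF assms(1,2)] by blast
  then show ?thesis
    by (rule schwartz_integrable_poly_mult[OF assms(3) wave_kernel_measurable[OF assms(1,2)]])
qed

text \<open>For each truncation this is the multiplication formula. In the limit the kernel side is
  dominated by the polynomial bound times |f|, the symbol side by the modulus of
  \<open>fourier f\<close>.\<close>

lemma integral_wave_kernel_mult:
  assumes \<alpha>: "\<alpha> > 1" and t: "t > 0" and f: "f \<in> schwartz"
  shows "of_real (2 * pi) * (LINT x|lborel. wave_kernel \<alpha> t x * f x) =
    (LINT \<gamma>|lborel. wave_symbol \<alpha> t \<gamma> * fourier f \<gamma>)"
proof -
  obtain D m where bd: "\<And>n x. norm (truncated_kernel \<alpha> t n x) \<le> D * (1 + x\<^sup>2) ^ m"
    using truncated_kernel_bound[OF \<alpha> t] by blast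
  \<comment> \<open>The majorant is taken complex-valued so that
    \<open>schwartz_integrable_poly_mult\<close> applies to it.\<close>
  define B where "B = (\<lambda>x. complex_of_real (D * (1 + x\<^sup>2) ^ m))"
  have D: "0 \<le> D" using order_trans[OF norm_ge_zero bd[of 0 0]] by simp
  have [measurable]: "B \<in> borel_measurable borel" unfolding B_def by measurable
  note [measurable] = schwartz_borel_measurable[OF f] schwartz_borel_measurable[OF fourier_schwartz[OF f]]
    wave_kernel_measurable[OF \<alpha> t]
  have B: "norm (B x) = D * (1 + x\<^sup>2) ^ m" for x
    unfolding B_def norm_of_real using D by (intro abs_of_nonneg mult_nonneg_nonneg zero_le_power) auto
  have lim1: "(\<lambda>n. LINT x|lborel. truncated_kernel \<alpha> t n x * f x) \<longlonglongrightarrow> (LINT x|lborel. wave_kernel \<alpha> t x * f x)"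
  proof (rule integral_dominated_convergence[where w = "\<lambda>x. norm (B x * f x)"])
    show "integrable lborel (\<lambda>x. norm (B x * f x))"
      by (intro integrable_norm schwartz_integrable_poly_mult[of f B D m] f) (simp_all add: B)
    show "AE x in lborel. (\<lambda>n. truncated_kernel \<alpha> t n x * f x) \<longlonglongrightarrow> wave_kernel \<alpha> t x * f x"
      by (intro AE_I2 tendsto_mult tendsto_const truncated_kernel_tendsto \<alpha> t)
    show "AE x in lborel. norm (truncated_kernel \<alpha> t n x * f x) \<le> norm (B x * f x)" for n
      unfolding norm_mult B by (intro AE_I2 mult_right_mono bd) simp
  qed measurable
  have lim2: "(\<lambda>n. LINT \<gamma>|lborel. (indicator {- real n..real n} \<gamma> *\<^sub>R wave_symbol \<alpha> t \<gamma>) * fourier f \<gamma>)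
      \<longlonglongrightarrow> (LINT \<gamma>|lborel. wave_symbol \<alpha> t \<gamma> * fourier f \<gamma>)"
  proof (rule integral_dominated_convergence[where w = "\<lambda>\<gamma>. norm (fourier f \<gamma>)"])
    show "integrable lborel (\<lambda>\<gamma>. norm (fourier f \<gamma>))"
      by (intro integrable_norm schwartz_integrable fourier_schwartz f)
    show "AE \<gamma> in lborel. (\<lambda>n. (indicator {- real n..real n} \<gamma> *\<^sub>R wave_symbol \<alpha> t \<gamma>) * fourier f \<gamma>)
      \<longlonglongrightarrow> wave_symbol \<alpha> t \<gamma> * fourier f \<gamma>"
    proof (intro AE_I2 tendsto_eventually)
      fix \<gamma> :: real
      obtain N :: nat where "\<bar>\<gamma>\<bar> \<le> real N" using real_arch_simple by blast
      then show "\<forall>\<^sub>F n in sequentially. (indicator {- real n..real n} \<gamma> *\<^sub>R wave_symbol \<alpha> t \<gamma>) * fourier f \<gamma>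
          = wave_symbol \<alpha> t \<gamma> * fourier f \<gamma>"
        by (intro eventually_sequentiallyI[of N]) (auto simp: indicator_def)
    qed
    show "AE \<gamma> in lborel. norm ((indicator {- real n..real n} \<gamma> *\<^sub>R wave_symbol \<alpha> t \<gamma>) * fourier f \<gamma>)
        \<le> norm (fourier f \<gamma>)" for n
      using norm_wave_symbol_le[of \<alpha> t]
      by (intro AE_I2) (auto simp: norm_mult indicator_def intro: mult_left_le_one_le)
  qed measurable
  have "of_real (2 * pi) * (LINT x|lborel. truncated_kernel \<alpha> t n x * f x) =
      (LINT \<gamma>|lborel. (indicator {- real n..real n} \<gamma> *\<^sub>R wave_symbol \<alpha> t \<gamma>) * fourier f \<gamma>)" for n
    unfolding fourier_multiplication[OF integrable_truncated_wave_symbol schwartz_integrable[OF f]]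
      integral_mult_right_zero[symmetric]
    by (intro Bochner_Integration.integral_cong) (simp_all add: truncated_kernel_def)
  then show ?thesis
    using LIMSEQ_unique[OF tendsto_mult_left[OF lim1, of "of_real (2 * pi)"]] lim2 by simp
qed

section \<open>Existence and uniqueness of the solution\<close>

text \<open>The symbol is even. This removes the reflection introduced by
  \<open>fourier_fourier\<close>.\<close>

lemma integral_wave_symbol_reflect:
  "(LINT \<gamma>|lborel. wave_symbol \<alpha> t \<gamma> * g (- \<gamma>)) = (LINT \<gamma>|lborel. wave_symbol \<alpha> t \<gamma> * g \<gamma>)"
  using lborel_integral_real_affine[of "-1" "\<lambda>\<gamma>. wave_symbol \<alpha> t \<gamma> * g \<gamma>" 0]
  by (simp add: wave_symbol_def)

text \<open>Take \<open>fourier f\<close> as test function in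
  \<open>integral_wave_kernel_mult\<close>: its own transform is 2 pi f(-\<gamma>), the reflection
  is absorbed by evenness, and 2 pi cancels.\<close>

lemma wave_kernel_solves_cauchy_problem:
  assumes \<alpha>: "\<alpha> > 1"
  shows "solves_cauchy_problem (2 * \<alpha>) (\<lambda>t f. LINT x|lborel. wave_kernel \<alpha> t x * f x)"
  unfolding solves_cauchy_problem_def
proof (intro exI[of _ "\<lambda>\<gamma> t. wave_symbol \<alpha> t \<gamma>"] conjI allI impI)
  show "solves_transformed_problem (2 * \<alpha>) \<gamma> (\<lambda>t. wave_symbol \<alpha> t \<gamma>)" for \<gamma>
    unfolding wave_symbol_def by (rule transformed_problem_cos)
  fix t :: real assume t: "t > 0"
  show "tempered_distribution (\<lambda>f. LINT x|lborel. wave_kernel \<alpha> t x * f x)"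
  proof -
    obtain D m where "\<And>x. norm (wave_kernel \<alpha> t x) \<le> D * (1 + x\<^sup>2) ^ m"
      using wave_kernel_bound[OF \<alpha> t] by blast
    then show ?thesis
      by (rule tempered_distribution_poly_bounded[OF wave_kernel_measurable[OF \<alpha> t]])
  qed
  show "represented_by (fourier_distribution (\<lambda>f. LINT x|lborel. wave_kernel \<alpha> t x * f x)) (\<lambda>\<gamma>. wave_symbol \<alpha> t \<gamma>)"
    unfolding represented_by_def fourier_distribution_def
  proof (intro ballI conjI)
    fix f assume f: "f \<in> schwartz"
    show "integrable lborel (\<lambda>\<gamma>. wave_symbol \<alpha> t \<gamma> * f \<gamma>)"
      by (rule schwartz_integrable_bounded_mult[OF f wave_symbol_measurable norm_wave_symbol_le])
    have "of_real (2 * pi) * (LINT x|lborel. wave_kernel \<alpha> t x * fourier f x) =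
        (LINT \<gamma>|lborel. of_real (2 * pi) * (wave_symbol \<alpha> t \<gamma> * f (- \<gamma>)))"
      unfolding integral_wave_kernel_mult[OF \<alpha> t fourier_schwartz[OF f]] fourier_fourier[OF f]
      by (simp add: mult_ac)
    also have "\<dots> = of_real (2 * pi) * (LINT \<gamma>|lborel. wave_symbol \<alpha> t \<gamma> * f \<gamma>)"
      unfolding integral_mult_right_zero integral_wave_symbol_reflect ..
    finally show "(LINT x|lborel. wave_kernel \<alpha> t x * fourier f x) = (LINT \<gamma>|lborel. wave_symbol \<alpha> t \<gamma> * f \<gamma>)"
      by simp
  qed
qed

text \<open>
  Applying the Fourier transform four times multiplies by \<open>(2 * pi)\<^sup>2\<close>, so every Schwartz function
  is a Fourier transform and the values of \<open>u t\<close> on Fourier transforms determine it.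
\<close>

lemma solves_cauchy_problem_represented_by_wave_kernel:
  assumes \<alpha>: "\<alpha> > 1" and u: "solves_cauchy_problem (2 * \<alpha>) u" and t: "t > 0"
  shows "represented_by (u t) (wave_kernel \<alpha> t)"
  unfolding represented_by_def
proof (intro ballI conjI)
  fix f assume f: "f \<in> schwartz"
  show "integrable lborel (\<lambda>x. wave_kernel \<alpha> t x * f x)"
    by (rule integrable_wave_kernel_mult[OF \<alpha> t f])
  obtain v where v: "\<And>\<gamma>. solves_transformed_problem (2 * \<alpha>) \<gamma> (v \<gamma>)"
    and temp: "tempered_distribution (u t)"
    and rep: "represented_by (fourier_distribution (u t)) (\<lambda>\<gamma>. v \<gamma> t)"
    using u t unfolding solves_cauchy_problem_def by blast
  have vt: "v \<gamma> t = wave_symbol \<alpha> t \<gamma>" for \<gamma>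
    using transformed_problem_unique[OF v] t by (simp add: wave_symbol_def)
  define F3 where "F3 = fourier (fourier (fourier f))"
  have F3: "F3 \<in> schwartz" unfolding F3_def by (intro fourier_schwartz f)
  let ?c = "complex_of_real (2 * pi)"
  \<comment> \<open>The summand \<open>0 * f x\<close> brings the function into the shape of the
    linearity clause of \<open>tempered_distribution\<close>.\<close>
  have "fourier F3 = (\<lambda>x. (?c * ?c) * f x + 0 * f x)"
    unfolding F3_def
    by (rule ext) (simp only: fourier_fourier[OF fourier_schwartz[OF fourier_schwartz[OF f]]]
        fourier_fourier[OF f] minus_minus mult_zero_left add_0_right mult.assoc)
  moreover have "u t (\<lambda>x. (?c * ?c) * f x + 0 * f x) = (?c * ?c) * u t f + 0 * u t f"
    using temp[unfolded tempered_distribution_def, THEN conjunct1, rule_format, OF f f] .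
  ultimately have "u t (fourier F3) = (?c * ?c) * u t f" by simp
  moreover have "u t (fourier F3) = (LINT \<gamma>|lborel. wave_symbol \<alpha> t \<gamma> * F3 \<gamma>)"
    using rep[unfolded represented_by_def, rule_format, OF F3]
    by (simp only: fourier_distribution_def vt)
  moreover have "(LINT \<gamma>|lborel. wave_symbol \<alpha> t \<gamma> * F3 \<gamma>) =
      (LINT \<gamma>|lborel. ?c * (wave_symbol \<alpha> t \<gamma> * fourier f (- \<gamma>)))"
    unfolding F3_def fourier_fourier[OF fourier_schwartz[OF f]] by (simp add: mult_ac)
  \<comment> \<open>One factor 2 pi comes from inversion, the other from
    \<open>integral_wave_kernel_mult\<close>; they match the square on the side of
    \<open>u t f\<close>.\<close>
  moreover have "\<dots> = ?c * (?c * (LINT x|lborel. wave_kernel \<alpha> t x * f x))"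
    unfolding integral_mult_right_zero integral_wave_symbol_reflect integral_wave_kernel_mult[OF \<alpha> t f] ..
  ultimately show "u t f = (LINT x|lborel. wave_kernel \<alpha> t x * f x)"
    by (simp add: mult.assoc)
qed

text \<open>The existence clause keeps the statement about all solutions from being vacuous.\<close>

theorem theorem3:
  fixes \<alpha> :: real
  assumes "\<alpha> > 1"
  shows "(\<exists>u. solves_cauchy_problem (2 * \<alpha>) u) \<and>
         (\<forall>u. solves_cauchy_problem (2 * \<alpha>) u \<longrightarrow>
            (\<forall>t>0. represented_by (u t)
               (\<lambda>x. complex_of_real
                  (1 / (2 * (\<alpha> * t) powr (1 / \<alpha>)) *
                   (airy \<alpha> (x / (\<alpha> * t) powr (1 / \<alpha>)) +
                    airy \<alpha> (- (x / (\<alpha> * t) powr (1 / \<alpha>))))))))"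
  using wave_kernel_solves_cauchy_problem[OF assms]
    solves_cauchy_problem_represented_by_wave_kernel[OF assms, unfolded wave_kernel_def]
  by (intro conjI exI allI impI)

end
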